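(* Let $\mathscr{F}$ be an idempotent topologizing system on the commutative ring $R$ and let $\phi:R\rightarrow S$ be a homomorphism of commutative rings such that $IS=S$ for all $I\in\mathscr{F}$. If there is an isomorphism of rings $\psi:R_{\mathscr{F}}\rightarrow S$ such that $\phi=\psi\circ j_R$, then $\phi:R\rightarrow S$ is a flat epimorphism and $\psi=j_S^{-1}\circ\phi_{\mathscr{F}}$.
   Context: All rings are commutative. A flat epimorphism is a ring map that is flat and is an epimorphism in the category of commutative rings. $IS$ denotes the ideal of $S$ generated by $\phi(I)$. A topologizing system on a ring $R$ is a non-empty family $\mathscr{F}$ of ideals of $R$ such that every ideal containing a member of $\mathscr{F}$ belongs to $\mathscr{F}$, and $\mathscr{F}$ is stable under finite intersections. An $R$-module $M$ is $\mathscr{F}$-negligible if $\operatorname{Ann}_R(m)\in\mathscr{F}$ for every $m\in M$. For topologizing systems $\mathscr{F},\mathscr{G}$ on $R$, $\mathscr{F}.\mathscr{G}$ is the set of ideals $I$ of $R$ for which there is $J\in\mathscr{G}$ with $I\subseteq J$ and $J/I$ $\mathscr{F}$-negligible; $\mathscr{F}$ is idempotent if $\mathscr{F}.\mathscr{F}=\mathscr{F}$. For an $R$-module $M$, $\mathscr{F}(M)=\{m\in M:\operatorname{Ann}_R(m)\in\mathscr{F}\}$ (a submodule), and the Gabriel localization is $M_{\mathscr{F}}=\operatorname{colim}_{I\in\mathscr{F}}\operatorname{Hom}_R(I,M/\mathscr{F}(M))$, where $\mathscr{F}$ is directed by reverse inclusion and the transition maps are restrictions; $[f]$ denotes the class of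 $f:I\to M/\mathscr{F}(M)$. The canonical map $j_M:M\to M_{\mathscr{F}}$ sends $m$ to the class of $R\to M/\mathscr{F}(M)$, $r\mapsto rm+\mathscr{F}(M)$. For an $R$-linear map $u:M\to N$, the map $u_{\mathscr{F}}:M_{\mathscr{F}}\to N_{\mathscr{F}}$ is $[f]\mapsto[\overline{u}\circ f]$, where $\overline{u}:M/\mathscr{F}(M)\to N/\mathscr{F}(N)$ is induced by $u$. $S$ is regarded as an $R$-module via $\phi$; under the hypothesis that $IS=S$ for all $I\in\mathscr{F}$, the map $j_S:S\to S_{\mathscr{F}}$ is bijective, so $j_S^{-1}$ makes sense. $R_{\mathscr{F}}$ is a commutative ring: for $f:I\to R/\mathscr{F}(R)$ and $g:J\to R/\mathscr{F}(R)$ $R$-linear with $I,J\in\mathscr{F}$, put $\overline{J}=(J+\mathscr{F}(R))/\mathscr{F}(R)$ and $\overline{g}:\overline{J}\to R/\mathscr{F}(R)$, $b+\mathscr{F}(R)\mapsto g(b)$ for $b\in J$; then $f^{-1}(\overline{J})\in\mathscr{F}$ and $[f].[g]=[\overline{g}\circ f|_{f^{-1}(\overline{J})}]$. The unit is the class of the canonical map $R\to R/\mathscr{F}(R)$, and $j_R:R\to R_{\mathscr{F}}$ is a ring homomorphism. *)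

theory Defs
  imports "HOL-Algebra.Module" "HOL-Algebra.QuotRing" "HOL-Algebra.Free_Abelian_Groups"
begin

section \<open>Modules over a commutative ring\<close>

text \<open>Modules are records in the sense of \<^locale>\<open>module\<close>. That locale ignores the fields
  \<^const>\<open>monoid.mult\<close> and \<^const>\<open>one\<close> of a module, so they carry no information below.\<close>

definition ideal_module :: "('a, 'c) ring_scheme \<Rightarrow> 'a set \<Rightarrow> ('a, 'a) module" where
  "ideal_module R I =
     \<lparr>carrier = I, monoid.mult = monoid.mult R, one = \<one>\<^bsub>R\<^esub>, ring.zero = \<zero>\<^bsub>R\<^esub>, add = add R,
      smult = monoid.mult R\<rparr>"

abbreviation self_module :: "('a, 'c) ring_scheme \<Rightarrow> ('a, 'a) module" where
  "self_module R \<equiv> ideal_module R (carrier R)"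

definition restrict_scalars :: "('a \<Rightarrow> 'b) \<Rightarrow> ('b, 'd) ring_scheme \<Rightarrow> ('a, 'b) module" where
  "restrict_scalars \<phi> S =
     \<lparr>carrier = carrier S, monoid.mult = monoid.mult S, one = \<one>\<^bsub>S\<^esub>, ring.zero = \<zero>\<^bsub>S\<^esub>, add = add S,
      smult = (\<lambda>r s. \<phi> r \<otimes>\<^bsub>S\<^esub> s)\<rparr>"

definition lin_maps ::
  "('a, 'c) ring_scheme \<Rightarrow> ('a, 'm, 'd) module_scheme \<Rightarrow> ('a, 'n, 'e) module_scheme \<Rightarrow> ('m \<Rightarrow> 'n) set"
where
  "lin_maps R M N = {f \<in> carrier M \<rightarrow> carrier N.
     (\<forall>x\<in>carrier M. \<forall>y\<in>carrier M. f (x \<oplus>\<^bsub>M\<^esub> y) = f x \<oplus>\<^bsub>N\<^esub> f y) \<and>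
     (\<forall>r\<in>carrier R. \<forall>x\<in>carrier M. f (r \<odot>\<^bsub>M\<^esub> x) = r \<odot>\<^bsub>N\<^esub> f x)}"

definition quot_module :: "('a, 'm, 'd) module_scheme \<Rightarrow> 'm set \<Rightarrow> ('a, 'm set) module" where
  "quot_module M N =
     \<lparr>carrier = a_rcosets\<^bsub>M\<^esub> N, monoid.mult = undefined, one = undefined, ring.zero = N, add = set_add M,
      smult = (\<lambda>r X. \<Union>x\<in>X. N +>\<^bsub>M\<^esub> (r \<odot>\<^bsub>M\<^esub> x))\<rparr>"

definition annihilator :: "('a, 'c) ring_scheme \<Rightarrow> ('a, 'm, 'd) module_scheme \<Rightarrow> 'm \<Rightarrow> 'a set" where
  "annihilator R M m = {r \<in> carrier R. r \<odot>\<^bsub>M\<^esub> m = \<zero>\<^bsub>M\<^esub>}"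


section \<open>Tensor products and flat epimorphisms\<close>

definition tensor_free ::
  "('a, 'm, 'd) module_scheme \<Rightarrow> ('a, 'n, 'e) module_scheme \<Rightarrow> ('m \<times> 'n \<Rightarrow>\<^sub>0 int) monoid" where
  "tensor_free M N = free_Abelian_group (carrier M \<times> carrier N)"

definition tensor_relations ::
  "('a, 'c) ring_scheme \<Rightarrow> ('a, 'm, 'd) module_scheme \<Rightarrow> ('a, 'n, 'e) module_scheme
     \<Rightarrow> ('m \<times> 'n \<Rightarrow>\<^sub>0 int) set" where
  "tensor_relations R M N =
     {frag_of (x \<oplus>\<^bsub>M\<^esub> x', y) - frag_of (x, y) - frag_of (x', y) | x x' y.
        x \<in> carrier M \<and> x' \<in> carrier M \<and> y \<in> carrier N} \<union>
     {frag_of (x, y \<oplus>\<^bsub>N\<^esub> y') - frag_of (x, y) - frag_of (x, y') | x y y'.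
        x \<in> carrier M \<and> y \<in> carrier N \<and> y' \<in> carrier N} \<union>
     {frag_of (r \<odot>\<^bsub>M\<^esub> x, y) - frag_of (x, r \<odot>\<^bsub>N\<^esub> y) | r x y.
        r \<in> carrier R \<and> x \<in> carrier M \<and> y \<in> carrier N}"

definition tensor_kernel ::
  "('a, 'c) ring_scheme \<Rightarrow> ('a, 'm, 'd) module_scheme \<Rightarrow> ('a, 'n, 'e) module_scheme
     \<Rightarrow> ('m \<times> 'n \<Rightarrow>\<^sub>0 int) set" where
  "tensor_kernel R M N = generate (tensor_free M N) (tensor_relations R M N)"

text \<open>The underlying abelian group of the tensor product (written multiplicatively, as
  \<^const>\<open>free_Abelian_group\<close> is); this is all that is needed to state flatness.\<close>

definition tensor ::
  "('a, 'c) ring_scheme \<Rightarrow> ('a, 'm, 'd) module_scheme \<Rightarrow> ('a, 'n, 'e) module_scheme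
     \<Rightarrow> ('m \<times> 'n \<Rightarrow>\<^sub>0 int) set monoid" where
  "tensor R M N = tensor_free M N Mod tensor_kernel R M N"

text \<open>\<open>tensor_map R M' P u\<close> is the map from \<open>M \<otimes> P\<close> to \<open>M' \<otimes> P\<close> induced by \<open>u\<close>. It acts on cosets:
  the coset of a formal sum of pairs \<open>(x, p)\<close> goes to the coset of the sum of the \<open>(u x, p)\<close>.\<close>

definition tensor_map ::
  "('a, 'c) ring_scheme \<Rightarrow> ('a, 'n, 'e) module_scheme \<Rightarrow> ('a, 'p, 'f) module_scheme
     \<Rightarrow> ('m \<Rightarrow> 'n) \<Rightarrow> ('m \<times> 'p \<Rightarrow>\<^sub>0 int) set \<Rightarrow> ('n \<times> 'p \<Rightarrow>\<^sub>0 int) set" where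
  "tensor_map R M' P u X = (THE Y. \<exists>c\<in>X.
     Y = tensor_kernel R M' P #>\<^bsub>tensor_free M' P\<^esub>
           frag_extend (\<lambda>(x, p). frag_of (u x, p)) c)"

text \<open>Flatness and the epimorphism property quantify over all modules, respectively all rings. HOL
  cannot quantify over types inside a definition, so the carrier types of the test objects are
  parameters. A theorem in which these are type variables asserts the property for test objects over
  arbitrary types.\<close>

definition flat_module ::
  "'m itself \<Rightarrow> 'n itself \<Rightarrow> ('a, 'c) ring_scheme \<Rightarrow> ('a, 'p, 'f) module_scheme \<Rightarrow> bool" where
  "flat_module _ _ R P \<longleftrightarrow> module R P \<and>
     (\<forall>(M :: ('a, 'm) module) (M' :: ('a, 'n) module) u.
        module R M \<longrightarrow> module R M' \<longrightarrow> u \<in> lin_maps R M M' \<longrightarrow> inj_on u (carrier M) \<longrightarrow>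
        inj_on (tensor_map R M' P u) (carrier (tensor R M P)))"

definition ring_epimorphism ::
  "'t itself \<Rightarrow> ('a, 'c) ring_scheme \<Rightarrow> ('b, 'd) ring_scheme \<Rightarrow> ('a \<Rightarrow> 'b) \<Rightarrow> bool" where
  "ring_epimorphism _ R S \<phi> \<longleftrightarrow> \<phi> \<in> ring_hom R S \<and>
     (\<forall>(T :: 't ring) g h. cring T \<longrightarrow> g \<in> ring_hom S T \<longrightarrow> h \<in> ring_hom S T \<longrightarrow>
        (\<forall>r\<in>carrier R. g (\<phi> r) = h (\<phi> r)) \<longrightarrow> (\<forall>s\<in>carrier S. g s = h s))"

definition flat_epimorphism ::
  "'m itself \<Rightarrow> 'n itself \<Rightarrow> 't itself \<Rightarrow>
     ('a, 'c) ring_scheme \<Rightarrow> ('b, 'd) ring_scheme \<Rightarrow> ('a \<Rightarrow> 'b) \<Rightarrow> bool" where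
  "flat_epimorphism tm tn tt R S \<phi> \<longleftrightarrow>
     flat_module tm tn R (restrict_scalars \<phi> S) \<and> ring_epimorphism tt R S \<phi>"


section \<open>Topologizing systems\<close>

definition topologizing_system :: "('a, 'c) ring_scheme \<Rightarrow> 'a set set \<Rightarrow> bool" where
  "topologizing_system R \<F> \<longleftrightarrow> \<F> \<noteq> {} \<and> (\<forall>I\<in>\<F>. ideal I R) \<and>
     (\<forall>I\<in>\<F>. \<forall>J. ideal J R \<longrightarrow> I \<subseteq> J \<longrightarrow> J \<in> \<F>) \<and> (\<forall>I\<in>\<F>. \<forall>J\<in>\<F>. I \<inter> J \<in> \<F>)"

definition negligible ::
  "('a, 'c) ring_scheme \<Rightarrow> 'a set set \<Rightarrow> ('a, 'm, 'd) module_scheme \<Rightarrow> bool" where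
  "negligible R \<F> M \<longleftrightarrow> (\<forall>m\<in>carrier M. annihilator R M m \<in> \<F>)"

definition system_product ::
  "('a, 'c) ring_scheme \<Rightarrow> 'a set set \<Rightarrow> 'a set set \<Rightarrow> 'a set set" where
  "system_product R \<F> \<G> =
     {I. ideal I R \<and> (\<exists>J\<in>\<G>. I \<subseteq> J \<and> negligible R \<F> (quot_module (ideal_module R J) I))}"

definition idempotent_system :: "('a, 'c) ring_scheme \<Rightarrow> 'a set set \<Rightarrow> bool" where
  "idempotent_system R \<F> \<longleftrightarrow> system_product R \<F> \<F> = \<F>"


section \<open>Gabriel localization\<close>

definition torsion ::
  "('a, 'c) ring_scheme \<Rightarrow> 'a set set \<Rightarrow> ('a, 'm, 'd) module_scheme \<Rightarrow> 'm set" where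
  "torsion R \<F> M = {m \<in> carrier M. annihilator R M m \<in> \<F>}"

abbreviation torsion_quot ::
  "('a, 'c) ring_scheme \<Rightarrow> 'a set set \<Rightarrow> ('a, 'm, 'd) module_scheme \<Rightarrow> ('a, 'm set) module" where
  "torsion_quot R \<F> M \<equiv> quot_module M (torsion R \<F> M)"

text \<open>The directed colimit is the set of pairs \<open>(I, f)\<close> modulo eventual agreement. The maps \<open>f\<close> are
  taken to be extensional, so that each linear map on \<open>I\<close> is represented by exactly one function.\<close>

definition gab_reps ::
  "('a, 'c) ring_scheme \<Rightarrow> 'a set set \<Rightarrow> ('a, 'm, 'd) module_scheme
     \<Rightarrow> ('a set \<times> ('a \<Rightarrow> 'm set)) set" where
  "gab_reps R \<F> M =
     {(I, f). I \<in> \<F> \<and> f \<in> lin_maps R (ideal_module R I) (torsion_quot R \<F> M) \<inter> extensional I}"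

definition gab_class ::
  "('a, 'c) ring_scheme \<Rightarrow> 'a set set \<Rightarrow> ('a, 'm, 'd) module_scheme
     \<Rightarrow> 'a set \<Rightarrow> ('a \<Rightarrow> 'm set) \<Rightarrow> ('a set \<times> ('a \<Rightarrow> 'm set)) set" where
  "gab_class R \<F> M I f =
     {(J, g) \<in> gab_reps R \<F> M. \<exists>K\<in>\<F>. K \<subseteq> I \<inter> J \<and> (\<forall>x\<in>K. f x = g x)}"

text \<open>Operations on classes are defined as unions over all representatives, in the style of
  \<^const>\<open>set_add\<close>. For an idempotent topologizing system the
  operations respect the equivalence, so every union is over equal classes. Similarly, the maps
  defined below by \<open>THE\<close> are well defined on the arguments at which they are used.\<close>

definition gab_module ::
  "('a, 'c) ring_scheme \<Rightarrow> 'a set set \<Rightarrow> ('a, 'm, 'd) module_scheme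
     \<Rightarrow> ('a, ('a set \<times> ('a \<Rightarrow> 'm set)) set) module" where
  "gab_module R \<F> M =
     \<lparr>carrier = (\<lambda>(I, f). gab_class R \<F> M I f) ` gab_reps R \<F> M,
      monoid.mult = undefined, one = undefined,
      ring.zero = gab_class R \<F> M (carrier R) (\<lambda>x\<in>carrier R. \<zero>\<^bsub>torsion_quot R \<F> M\<^esub>),
      add = (\<lambda>A B. \<Union>(I, f)\<in>A. \<Union>(J, g)\<in>B.
               gab_class R \<F> M (I \<inter> J) (\<lambda>x\<in>I \<inter> J. f x \<oplus>\<^bsub>torsion_quot R \<F> M\<^esub> g x)),
      smult = (\<lambda>r A. \<Union>(I, f)\<in>A.
               gab_class R \<F> M I (\<lambda>x\<in>I. r \<odot>\<^bsub>torsion_quot R \<F> M\<^esub> f x))\<rparr>"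

definition gab_unit ::
  "('a, 'c) ring_scheme \<Rightarrow> 'a set set \<Rightarrow> ('a, 'm, 'd) module_scheme
     \<Rightarrow> 'm \<Rightarrow> ('a set \<times> ('a \<Rightarrow> 'm set)) set" where
  "gab_unit R \<F> M m =
     gab_class R \<F> M (carrier R) (\<lambda>r\<in>carrier R. torsion R \<F> M +>\<^bsub>M\<^esub> (r \<odot>\<^bsub>M\<^esub> m))"

definition torsion_quot_map ::
  "('a, 'c) ring_scheme \<Rightarrow> 'a set set \<Rightarrow> ('a, 'n, 'e) module_scheme
     \<Rightarrow> ('m \<Rightarrow> 'n) \<Rightarrow> 'm set \<Rightarrow> 'n set" where
  "torsion_quot_map R \<F> N u X = (THE Y. \<exists>m\<in>X. Y = torsion R \<F> N +>\<^bsub>N\<^esub> u m)"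

definition gab_map ::
  "('a, 'c) ring_scheme \<Rightarrow> 'a set set \<Rightarrow> ('a, 'n, 'e) module_scheme
     \<Rightarrow> ('m \<Rightarrow> 'n) \<Rightarrow> ('a set \<times> ('a \<Rightarrow> 'm set)) set \<Rightarrow> ('a set \<times> ('a \<Rightarrow> 'n set)) set" where
  "gab_map R \<F> N u A =
     (\<Union>(I, f)\<in>A. gab_class R \<F> N I (\<lambda>x\<in>I. torsion_quot_map R \<F> N u (f x)))"

definition image_in_torsion_quot ::
  "('a, 'c) ring_scheme \<Rightarrow> 'a set set \<Rightarrow> 'a set \<Rightarrow> 'a set set" where
  "image_in_torsion_quot R \<F> J =
     (let T = torsion R \<F> (self_module R) in (\<lambda>x. T +>\<^bsub>R\<^esub> x) ` (J <+>\<^bsub>R\<^esub> T))"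

definition factor_through_torsion ::
  "('a, 'c) ring_scheme \<Rightarrow> 'a set set \<Rightarrow> 'a set \<Rightarrow> ('a \<Rightarrow> 'a set) \<Rightarrow> 'a set \<Rightarrow> 'a set" where
  "factor_through_torsion R \<F> J g X =
     (THE Y. \<exists>b\<in>J. X = torsion R \<F> (self_module R) +>\<^bsub>R\<^esub> b \<and> Y = g b)"

text \<open>On representatives, the product of \<open>f\<close> on \<open>I\<close> and \<open>g\<close> on \<open>J\<close> is the composite of \<open>f\<close> with
  the map that \<open>g\<close> induces on the image of \<open>J\<close> in the torsion quotient, defined on the preimage
  under \<open>f\<close> of that image.\<close>

definition gab_mult ::
  "('a, 'c) ring_scheme \<Rightarrow> 'a set set \<Rightarrow> ('a set \<times> ('a \<Rightarrow> 'a set)) set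
     \<Rightarrow> ('a set \<times> ('a \<Rightarrow> 'a set)) set \<Rightarrow> ('a set \<times> ('a \<Rightarrow> 'a set)) set" where
  "gab_mult R \<F> A B = (\<Union>(I, f)\<in>A. \<Union>(J, g)\<in>B.
     (let K = {x \<in> I. f x \<in> image_in_torsion_quot R \<F> J}
      in gab_class R \<F> (self_module R) K (\<lambda>x\<in>K. factor_through_torsion R \<F> J g (f x))))"

definition gab_ring ::
  "('a, 'c) ring_scheme \<Rightarrow> 'a set set \<Rightarrow> (('a set \<times> ('a \<Rightarrow> 'a set)) set) ring" where
  "gab_ring R \<F> =
     \<lparr>carrier = carrier (gab_module R \<F> (self_module R)),
      monoid.mult = gab_mult R \<F>,
      one = gab_class R \<F> (self_module R) (carrier R)
              (\<lambda>r\<in>carrier R. torsion R \<F> (self_module R) +>\<^bsub>R\<^esub> r),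
      ring.zero = \<zero>\<^bsub>gab_module R \<F> (self_module R)\<^esub>,
      add = add (gab_module R \<F> (self_module R))\<rparr>"

end

theory Submission
  imports Defs
begin

text \<open>
  Write \<open>T\<close> for the \<open>\<F>\<close>-torsion ideal of \<open>R\<close> and \<open>j\<close> for the canonical map from \<open>R\<close> to
  \<open>R\<^sub>\<F>\<close>. Two properties of \<open>\<phi>\<close> carry the proof: its kernel is \<open>\<F>\<close>-torsion, and every \<open>s\<close> in
  \<open>S\<close> has denominators, that is, \<open>\<phi>(I) s \<subseteq> \<phi>(R)\<close> for some \<open>I \<in> \<F>\<close>. Both come from \<open>R\<^sub>\<F>\<close>.

  \<^item> If \<open>j r = 0\<close> then \<open>K r \<subseteq> T\<close> for some \<open>K \<in> \<F>\<close>, and idempotency of \<open>\<F>\<close> says precisely that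
    being torsion can be tested after multiplication by all elements of such a \<open>K\<close>
    (\<open>torsion_local\<close>). So \<open>r \<in> T\<close>.
  \<^item> If \<open>A\<close> is the class of \<open>f : I \<rightarrow> R/T\<close> and \<open>f x = T + y\<close>, then \<open>j x \<cdot> A = j y\<close>
    (\<open>gab_mult_unit\<close>): for \<open>z\<close> in a small enough
    member of \<open>\<F>\<close>, the left side takes \<open>z\<close> to \<open>f (z x) = z f x = T + z y\<close>. Applying \<open>\<psi>\<close>
    gives \<open>\<phi> x \<cdot> \<psi> A = \<phi> y\<close> for all \<open>x \<in> I\<close>, so \<open>I\<close> consists of denominators of \<open>\<psi> A\<close>.

  The hypothesis \<open>I S = S\<close> always enters as a local-to-global principle: an ideal of \<open>S\<close> that
  contains \<open>\<phi>(I)\<close> for some \<open>I \<in> \<F>\<close> contains 1 (\<open>ideal_eq_carrier\<close>). It is applied to three kinds of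
  ideals.

  \<^item> Annihilators of elements of \<open>S\<close>: as an \<open>R\<close>-module, \<open>S\<close> has no torsion, so \<open>j\<^sub>S\<close> is injective
    and \<open>\<phi>\<close> kills \<open>T\<close>. The identity \<open>\<phi> x \<cdot> \<psi> A = \<phi> y\<close> then says that \<open>\<phi>\<^sub>\<F> A\<close> and \<open>j\<^sub>S (\<psi> A)\<close>
    have representatives agreeing on \<open>I\<close>, which is the formula for \<open>\<psi>\<close>.
  \<^item> The ideal of all \<open>t\<close> with \<open>g s \<cdot> h t = h s \<cdot> h t\<close>, where \<open>g\<close> and \<open>h\<close> are ring maps on \<open>S\<close> that
    agree on \<open>\<phi>(R)\<close>: it contains all \<open>\<phi> x\<close> with \<open>x\<close> a denominator of \<open>s\<close>. So \<open>g s = h s\<close>, and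
    \<open>\<phi>\<close> is an epimorphism.
  \<^item> The ideal of all \<open>s\<close> with \<open>s w = 0\<close>, for \<open>w\<close> in \<open>M \<otimes> S\<close>. Multiplying \<open>w\<close> by a common denominator
    \<open>x\<close> gives an element \<open>m \<otimes> 1\<close>, where \<open>m \<in> M\<close> is determined up to torsion. The main point of
    flatness is that \<open>w = 0\<close> if and only if all these \<open>m\<close>, for \<open>x\<close> in some member of \<open>\<F>\<close>, are
    torsion (\<open>kernel_iff_clear_denom_torsion\<close>). An injective linear map reflects torsion, because it
    preserves annihilators of elements; hence it remains injective after tensoring with \<open>S\<close>.
\<close>

section \<open>Quotient modules\<close>

context module
begin

lemma submodule_imp_abelian_subgroup: "submodule N R M \<Longrightarrow> abelian_subgroup N M"
  by (intro abelian_subgroupI3 additive_subgroupI submodule.axioms(1) M.abelian_group_axioms)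

lemma coset_eq_iff:
  assumes N: "submodule N R M" and "x \<in> carrier M" "y \<in> carrier M"
  shows "N +>\<^bsub>M\<^esub> x = N +>\<^bsub>M\<^esub> y \<longleftrightarrow> x \<ominus>\<^bsub>M\<^esub> y \<in> N"
proof -
  interpret N: abelian_subgroup N M
    by (rule submodule_imp_abelian_subgroup[OF N])
  have "N +>\<^bsub>M\<^esub> x = N +>\<^bsub>M\<^esub> y \<longleftrightarrow> x \<in> N +>\<^bsub>M\<^esub> y"
    using N.a_repr_independence'[of x y, OF _ assms(3)] N.a_repr_independenceD[of x y, OF assms(2)] by blast
  then show ?thesis
    using N.a_rcos_module[OF assms(3,2)] by (simp add: a_minus_def)
qed

lemma minus_zero_M: "\<ominus>\<^bsub>M\<^esub> \<zero>\<^bsub>M\<^esub> = \<zero>\<^bsub>M\<^esub>"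
  by (rule M.minus_equality) auto

lemma coset_eq_zero_iff:
  assumes "submodule N R M" and "x \<in> carrier M"
  shows "N +>\<^bsub>M\<^esub> x = N \<longleftrightarrow> x \<in> N"
  using coset_eq_iff[OF assms(1,2) M.zero_closed] assms M.a_coset_add_zero[of N] 
    submoduleE(1)[OF assms(1)]
  by (simp add: a_minus_def minus_zero_M)

lemma quot_add:
  assumes N: "submodule N R M" and "x \<in> carrier M" "y \<in> carrier M"
  shows "(N +>\<^bsub>M\<^esub> x) \<oplus>\<^bsub>quot_module M N\<^esub> (N +>\<^bsub>M\<^esub> y) = N +>\<^bsub>M\<^esub> (x \<oplus>\<^bsub>M\<^esub> y)"
  using abelian_subgroup.a_rcos_sum[OF submodule_imp_abelian_subgroup[OF N]] assms
  by (simp add: quot_module_def)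

lemma quot_smult:
  assumes N: "submodule N R M" and r: "r \<in> carrier R" and x: "x \<in> carrier M"
  shows "r \<odot>\<^bsub>quot_module M N\<^esub> (N +>\<^bsub>M\<^esub> x) = N +>\<^bsub>M\<^esub> (r \<odot>\<^bsub>M\<^esub> x)"
proof -
  interpret N: abelian_subgroup N M
    by (rule submodule_imp_abelian_subgroup[OF N])
  have "N +>\<^bsub>M\<^esub> (r \<odot>\<^bsub>M\<^esub> z) = N +>\<^bsub>M\<^esub> (r \<odot>\<^bsub>M\<^esub> x)" if z: "z \<in> N +>\<^bsub>M\<^esub> x" for z
  proof -
    have zM: "z \<in> carrier M"
      using N.a_elemrcos_carrier[OF x z] .
    have "z \<ominus>\<^bsub>M\<^esub> x \<in> N"
      using N.a_rcos_module[OF x zM] z by (simp add: a_minus_def)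
    then have "r \<odot>\<^bsub>M\<^esub> (z \<ominus>\<^bsub>M\<^esub> x) \<in> N"
      using submoduleE(4)[OF N r] by blast
    then have "r \<odot>\<^bsub>M\<^esub> z \<ominus>\<^bsub>M\<^esub> r \<odot>\<^bsub>M\<^esub> x \<in> N"
      using r x zM by (simp add: a_minus_def smult_r_distr smult_r_minus)
    then show ?thesis
      using coset_eq_iff[OF N] r x zM by simp
  qed
  moreover have "x \<in> N +>\<^bsub>M\<^esub> x"
    by (rule N.a_rcos_self[OF x])
  ultimately have "(\<Union>z\<in>N +>\<^bsub>M\<^esub> x. N +>\<^bsub>M\<^esub> (r \<odot>\<^bsub>M\<^esub> z)) = N +>\<^bsub>M\<^esub> (r \<odot>\<^bsub>M\<^esub> x)"
    by blast
  then show ?thesis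
    by (simp add: quot_module_def)
qed

lemma quot_carrierE:
  assumes "X \<in> carrier (quot_module M N)"
  obtains x where "x \<in> carrier M" "X = N +>\<^bsub>M\<^esub> x"
proof -
  have "X \<in> (\<Union>a\<in>carrier M. {N +>\<^bsub>M\<^esub> a})"
    using assms unfolding quot_module_def A_RCOSETS_def' by simp
  then show thesis
    using that by blast
qed

lemma quot_carrierI: "x \<in> carrier M \<Longrightarrow> N +>\<^bsub>M\<^esub> x \<in> carrier (quot_module M N)"
  unfolding quot_module_def A_RCOSETS_def' by simp blast

text \<open>This turns the negligibility of \<open>J/I\<close> in the product of two systems into a condition on
  elements of \<open>J\<close>.\<close>

lemma annihilator_quot:
  assumes N: "submodule N R M" and "x \<in> carrier M"
  shows "annihilator R (quot_module M N) (N +>\<^bsub>M\<^esub> x) = {r \<in> carrier R. r \<odot>\<^bsub>M\<^esub> x \<in> N}"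
proof -
  have "r \<odot>\<^bsub>quot_module M N\<^esub> (N +>\<^bsub>M\<^esub> x) = \<zero>\<^bsub>quot_module M N\<^esub> \<longleftrightarrow> r \<odot>\<^bsub>M\<^esub> x \<in> N"
    if "r \<in> carrier R" for r
  proof -
    have "\<zero>\<^bsub>quot_module M N\<^esub> = N"
      by (simp add: quot_module_def)
    then show ?thesis
      using assms that by (simp only: quot_smult coset_eq_zero_iff smult_closed)
  qed
  then show ?thesis
    unfolding annihilator_def by blast
qed

lemma transporter_ideal:
  assumes N: "submodule N R M" and x: "x \<in> carrier M"
  shows "ideal {r \<in> carrier R. r \<odot>\<^bsub>M\<^esub> x \<in> N} R"
proof (rule idealI)
  show "subgroup {r \<in> carrier R. r \<odot>\<^bsub>M\<^esub> x \<in> N} (add_monoid R)"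
  proof (rule R.add.subgroupI)
    have "\<zero> \<odot>\<^bsub>M\<^esub> x \<in> N"
      using x subgroup.one_closed[OF submodule.axioms(1)[OF N]] by simp
    then show "{r \<in> carrier R. r \<odot>\<^bsub>M\<^esub> x \<in> N} \<noteq> {}"
      by blast
  next
    fix r assume r: "r \<in> {r \<in> carrier R. r \<odot>\<^bsub>M\<^esub> x \<in> N}"
    then show "\<ominus> r \<in> {r \<in> carrier R. r \<odot>\<^bsub>M\<^esub> x \<in> N}"
      using submoduleE(3)[OF N] x by (simp add: smult_l_minus)
  qed (use x submoduleE(5)[OF N] in \<open>auto simp: smult_l_distr\<close>)
next
  fix a r assume a: "a \<in> {r \<in> carrier R. r \<odot>\<^bsub>M\<^esub> x \<in> N}" and r: "r \<in> carrier R"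
  then have "r \<odot>\<^bsub>M\<^esub> (a \<odot>\<^bsub>M\<^esub> x) \<in> N"
    using submoduleE(4)[OF N] by blast
  then show "r \<otimes> a \<in> {r \<in> carrier R. r \<odot>\<^bsub>M\<^esub> x \<in> N}"
    using a r x by (simp add: smult_assoc1)
  then show "a \<otimes> r \<in> {r \<in> carrier R. r \<odot>\<^bsub>M\<^esub> x \<in> N}"
    using a r by (simp add: R.m_comm)
qed (rule R.ring_axioms)

lemma zero_submodule: "submodule {\<zero>\<^bsub>M\<^esub>} R M"
  by (rule submoduleI) auto

lemma annihilator_ideal: "m \<in> carrier M \<Longrightarrow> ideal (annihilator R M m) R"
  using transporter_ideal[OF zero_submodule] by (simp add: annihilator_def)

end

lemma ideal_module_sel [simp]:
  "carrier (ideal_module R I) = I" "\<zero>\<^bsub>ideal_module R I\<^esub> = \<zero>\<^bsub>R\<^esub>"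
  "x \<oplus>\<^bsub>ideal_module R I\<^esub> y = x \<oplus>\<^bsub>R\<^esub> y" "r \<odot>\<^bsub>ideal_module R I\<^esub> x = r \<otimes>\<^bsub>R\<^esub> x"
  by (simp_all add: ideal_module_def)

lemma r_coset_ideal_module [simp]: "N +>\<^bsub>ideal_module R I\<^esub> x = N +>\<^bsub>R\<^esub> x"
  by (simp add: a_r_coset_def')

lemma a_minus_self_module [simp]: "x \<ominus>\<^bsub>self_module R\<^esub> y = x \<ominus>\<^bsub>R\<^esub> y"
  by (simp add: a_minus_def a_inv_def m_inv_def)

lemma (in cring) ideal_module_is_module:
  assumes "ideal I R"
  shows "module R (ideal_module R I)"
proof -
  interpret I: ideal I R by fact
  have add: "abelian_group (ideal_module R I)"
  proof (rule abelian_groupI)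
    fix x assume "x \<in> carrier (ideal_module R I)"
    then show "\<exists>y\<in>carrier (ideal_module R I). y \<oplus>\<^bsub>ideal_module R I\<^esub> x = \<zero>\<^bsub>ideal_module R I\<^esub>"
      by (auto intro!: bexI[of _ "\<ominus> x"] l_neg)
  qed (auto simp: a_ac I.a_subset[THEN subsetD])
  show ?thesis
    by (rule moduleI[OF cring_axioms add])
      (auto simp: I.a_subset[THEN subsetD] l_distr r_distr m_assoc I.I_l_closed)
qed

lemma (in cring) self_module_is_module: "module R (self_module R)"
  by (rule ideal_module_is_module[OF oneideal])

lemma (in cring) submodule_ideal_module:
  assumes "ideal A R" "ideal I R" "A \<subseteq> I"
  shows "submodule A R (ideal_module R I)"
proof -
  interpret I: module R "ideal_module R I" by (rule ideal_module_is_module) fact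
  interpret A: ideal A R by fact
  have "\<ominus>\<^bsub>ideal_module R I\<^esub> a \<in> A" if "a \<in> A" for a
  proof -
    have "\<ominus>\<^bsub>ideal_module R I\<^esub> a = \<ominus> a"
      using that assms A.a_subset[THEN subsetD]
      by (intro I.minus_equality) (auto simp: l_neg)
    then show ?thesis using that by simp
  qed
  then show ?thesis
    using assms by (intro I.submoduleI) (auto simp: A.I_l_closed)
qed

section \<open>Torsion with respect to an idempotent topologizing system\<close>

locale gabriel_system = R?: cring R for R (structure) +
  fixes \<F> :: "'a set set"
  assumes topologizing: "topologizing_system R \<F>"
    and idempotent: "idempotent_system R \<F>"
begin

lemma F_ideal: "I \<in> \<F> \<Longrightarrow> ideal I R"
  and F_mono: "\<lbrakk>I \<in> \<F>; ideal J R; I \<subseteq> J\<rbrakk> \<Longrightarrow> J \<in> \<F>"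
  and F_Int: "\<lbrakk>I \<in> \<F>; J \<in> \<F>\<rbrakk> \<Longrightarrow> I \<inter> J \<in> \<F>"
  using topologizing unfolding topologizing_system_def by metis+

lemma F_subset: "I \<in> \<F> \<Longrightarrow> I \<subseteq> carrier R"
  by (rule additive_subgroup.a_subset[OF ideal.axioms(1)[OF F_ideal]])

lemma F_carrier: "carrier R \<in> \<F>"
proof -
  obtain I where "I \<in> \<F>"
    using topologizing by (auto simp: topologizing_system_def)
  then show ?thesis
    using F_mono[OF _ oneideal] F_subset by blast
qed

text \<open>The elementwise form of idempotency. The transporters of the \<open>x \<in> K\<close> into \<open>A\<close> are the
  annihilators of the elements of \<open>K/(A \<inter> K)\<close>, so the hypothesis makes this module negligible and
  puts \<open>A \<inter> K\<close> into the product of \<open>\<F>\<close> with itself.\<close>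

lemma F_local:
  assumes A: "ideal A R" and K: "K \<in> \<F>"
    and trans: "\<And>x. x \<in> K \<Longrightarrow> {r \<in> carrier R. r \<otimes> x \<in> A} \<in> \<F>"
  shows "A \<in> \<F>"
proof -
  interpret K: ideal K R using F_ideal[OF K] .
  interpret KM: module R "ideal_module R K" by (rule ideal_module_is_module) (rule F_ideal[OF K])
  have AK: "ideal (A \<inter> K) R"
    using i_intersect A K.is_ideal by blast
  have sub: "submodule (A \<inter> K) R (ideal_module R K)"
    using submodule_ideal_module[OF AK K.is_ideal] by blast
  have "negligible R \<F> (quot_module (ideal_module R K) (A \<inter> K))"
    unfolding negligible_def
  proof
    fix X assume "X \<in> carrier (quot_module (ideal_module R K) (A \<inter> K))"
    then obtain x where x: "x \<in> carrier (ideal_module R K)" "X = (A \<inter> K) +>\<^bsub>ideal_module R K\<^esub> x"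
      by (rule KM.quot_carrierE)
    have xK: "x \<in> K" using x by simp
    have "annihilator R (quot_module (ideal_module R K) (A \<inter> K)) X
        = {r \<in> carrier R. r \<odot>\<^bsub>ideal_module R K\<^esub> x \<in> A \<inter> K}"
      using KM.annihilator_quot[OF sub x(1)] x(2) by simp
    also have "\<dots> = {r \<in> carrier R. r \<otimes> x \<in> A}"
      using xK K.I_l_closed by auto
    finally show "annihilator R (quot_module (ideal_module R K) (A \<inter> K)) X \<in> \<F>"
      using trans[OF xK] by simp
  qed
  then have "A \<inter> K \<in> system_product R \<F> \<F>"
    using AK K by (auto simp: system_product_def)
  then have "A \<inter> K \<in> \<F>"
    using idempotent by (simp add: idempotent_system_def)
  then show ?thesis
    using F_mono[OF _ A] by blast
qed

end

locale gabriel_module = gabriel_system R \<F> + module R M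
  for R (structure) and \<F> and M (structure)
begin

lemma torsionI:
  assumes "I \<in> \<F>" "m \<in> carrier M" "I \<subseteq> annihilator R M m"
  shows "m \<in> torsion R \<F> M"
  using F_mono[OF assms(1) annihilator_ideal[OF assms(2)] assms(3)] assms(2)
  by (simp add: torsion_def)

lemma torsion_submodule: "submodule (torsion R \<F> M) R M"
proof (rule submoduleI)
  show "torsion R \<F> M \<subseteq> carrier M"
    by (auto simp: torsion_def)
  have "annihilator R M \<zero>\<^bsub>M\<^esub> = carrier R"
    by (auto simp: annihilator_def)
  then show "\<zero>\<^bsub>M\<^esub> \<in> torsion R \<F> M"
    using F_carrier by (simp add: torsion_def)
  fix a assume a: "a \<in> torsion R \<F> M"
  have "annihilator R M a = annihilator R M (\<ominus>\<^bsub>M\<^esub> a)"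
    using a by (auto simp: annihilator_def torsion_def smult_r_minus)
  then show "\<ominus>\<^bsub>M\<^esub> a \<in> torsion R \<F> M"
    using a by (simp add: torsion_def)
  {
    fix b assume b: "b \<in> torsion R \<F> M"
    have "annihilator R M a \<inter> annihilator R M b \<subseteq> annihilator R M (a \<oplus>\<^bsub>M\<^esub> b)"
      using a b by (auto simp: annihilator_def torsion_def smult_r_distr)
    moreover have "annihilator R M a \<inter> annihilator R M b \<in> \<F>"
      using a b by (intro F_Int) (auto simp: torsion_def)
    ultimately show "a \<oplus>\<^bsub>M\<^esub> b \<in> torsion R \<F> M"
      using a b by (intro torsionI[of "annihilator R M a \<inter> annihilator R M b"]) (auto simp: torsion_def)
  }
  fix r assume r: "r \<in> carrier R"
  have "annihilator R M a \<subseteq> annihilator R M (r \<odot>\<^bsub>M\<^esub> a)"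
  proof
    fix t assume t: "t \<in> annihilator R M a"
    then have "t \<in> carrier R" "t \<odot>\<^bsub>M\<^esub> a = \<zero>\<^bsub>M\<^esub>" "a \<in> carrier M"
      using a by (simp_all add: annihilator_def torsion_def)
    then have "t \<odot>\<^bsub>M\<^esub> (r \<odot>\<^bsub>M\<^esub> a) = \<zero>\<^bsub>M\<^esub>"
      using r smult_assoc1[of t r a] smult_assoc1[of r t a] m_comm[of t r] by simp
    then show "t \<in> annihilator R M (r \<odot>\<^bsub>M\<^esub> a)"
      using t r by (simp add: annihilator_def)
  qed
  then show "r \<odot>\<^bsub>M\<^esub> a \<in> torsion R \<F> M"
    using a r by (intro torsionI[of "annihilator R M a"]) (auto simp: torsion_def)
qed

text \<open>The torsion quotient of \<open>M\<close> has no torsion: the transporters of the \<open>x \<in> K\<close> into the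
  annihilator of \<open>m\<close> are the annihilators of the elements \<open>x m\<close>.\<close>

lemma torsion_local:
  assumes m: "m \<in> carrier M" and K: "K \<in> \<F>"
    and tors: "\<And>x. x \<in> K \<Longrightarrow> x \<odot>\<^bsub>M\<^esub> m \<in> torsion R \<F> M"
  shows "m \<in> torsion R \<F> M"
proof -
  have "annihilator R M m \<in> \<F>"
  proof (rule F_local[OF annihilator_ideal[OF m] K])
    fix x assume x: "x \<in> K"
    then have "x \<in> carrier R" using F_subset K by blast
    then have "{r \<in> carrier R. r \<otimes> x \<in> annihilator R M m} = annihilator R M (x \<odot>\<^bsub>M\<^esub> m)"
      using m by (auto simp: annihilator_def smult_assoc1)
    then show "{r \<in> carrier R. r \<otimes> x \<in> annihilator R M m} \<in> \<F>"
      using tors[OF x] by (simp add: torsion_def)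
  qed
  then show ?thesis
    using m by (simp add: torsion_def)
qed

lemma smult_torsion_closed:
  assumes t: "t \<in> torsion R \<F> (self_module R)" and m: "m \<in> carrier M"
  shows "t \<odot>\<^bsub>M\<^esub> m \<in> torsion R \<F> M"
proof -
  have tR: "t \<in> carrier R" and ann: "annihilator R (self_module R) t \<in> \<F>"
    using t by (auto simp: torsion_def)
  have "annihilator R (self_module R) t \<subseteq> annihilator R M (t \<odot>\<^bsub>M\<^esub> m)"
    using tR m by (auto simp: annihilator_def simp flip: smult_assoc1)
  then show ?thesis
    using torsionI[OF ann] tR m by simp
qed

end

section \<open>Gabriel localization\<close>

context gabriel_module
begin

lemma gab_repsD:
  assumes "(I, f) \<in> gab_reps R \<F> M"
  shows "I \<in> \<F>" "ideal I R" "I \<subseteq> carrier R"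
    and "\<And>x. x \<in> I \<Longrightarrow> \<exists>m\<in>carrier M. f x = torsion R \<F> M +>\<^bsub>M\<^esub> m"
    and "\<And>r x. \<lbrakk>r \<in> carrier R; x \<in> I\<rbrakk> \<Longrightarrow> f (r \<otimes> x) = r \<odot>\<^bsub>torsion_quot R \<F> M\<^esub> f x"
proof -
  show "I \<in> \<F>"
    using assms by (simp add: gab_reps_def)
  then show "ideal I R" "I \<subseteq> carrier R"
    by (rule F_ideal, rule F_subset)
  have f: "f \<in> lin_maps R (ideal_module R I) (torsion_quot R \<F> M)"
    using assms by (simp add: gab_reps_def)
  then have "f x \<in> carrier (torsion_quot R \<F> M)" if "x \<in> I" for x
    using that by (auto simp: lin_maps_def)
  then show "\<exists>m\<in>carrier M. f x = torsion R \<F> M +>\<^bsub>M\<^esub> m" if "x \<in> I" for x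
    by (rule quot_carrierE[of "f x" "torsion R \<F> M"]) (use that in blast)+
  show "f (r \<otimes> x) = r \<odot>\<^bsub>torsion_quot R \<F> M\<^esub> f x" if "r \<in> carrier R" "x \<in> I" for r x
    using that f by (simp add: lin_maps_def)
qed

lemma gab_classD:
  assumes "(J, g) \<in> gab_class R \<F> M I f"
  shows "(J, g) \<in> gab_reps R \<F> M"
    and "\<exists>K\<in>\<F>. K \<subseteq> I \<inter> J \<and> (\<forall>x\<in>K. f x = g x)"
  using assms by (simp_all add: gab_class_def)

text \<open>Stated for arbitrary pairs, because the unions that define the operations on the localization
  are over classes of computed pairs: to evaluate such a union it is enough to compare each of these
  pairs with a known representative on one member of \<open>\<F>\<close>.\<close>

lemma gab_class_eqI:
  assumes L: "L \<in> \<F>" "L \<subseteq> I \<inter> I'" "\<And>x. x \<in> L \<Longrightarrow> f x = f' x"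
  shows "gab_class R \<F> M I f = gab_class R \<F> M I' f'"
proof -
  have "gab_class R \<F> M I1 f1 \<subseteq> gab_class R \<F> M I2 f2"
    if L': "L \<subseteq> I2" "\<forall>x\<in>L. f1 x = f2 x" for I1 I2 and f1 f2 :: "'a \<Rightarrow> 'c set"
  proof clarify
    fix J g assume Jg: "(J, g) \<in> gab_class R \<F> M I1 f1"
    then obtain K where K: "K \<in> \<F>" "K \<subseteq> I1 \<inter> J" "\<forall>x\<in>K. f1 x = g x"
      by (auto simp: gab_class_def)
    have "K \<inter> L \<subseteq> I2 \<inter> J" "\<forall>x\<in>K \<inter> L. f2 x = g x"
      using K L' by auto
    then show "(J, g) \<in> gab_class R \<F> M I2 f2"
      using F_Int[OF K(1) L(1)] Jg unfolding gab_class_def by blast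
  qed
  from this[of I' f f'] this[of I f' f] show ?thesis
    using L by auto
qed

lemma gab_class_self: "(I, f) \<in> gab_reps R \<F> M \<Longrightarrow> (I, f) \<in> gab_class R \<F> M I f"
proof -
  assume "(I, f) \<in> gab_reps R \<F> M"
  moreover from gab_repsD(1)[OF this] have "\<exists>K\<in>\<F>. K \<subseteq> I \<inter> I \<and> (\<forall>x\<in>K. f x = f x)"
    by blast
  ultimately show ?thesis
    by (simp add: gab_class_def)
qed

lemma gab_carrierE:
  assumes "A \<in> carrier (gab_module R \<F> M)"
  obtains I f where "(I, f) \<in> gab_reps R \<F> M" "A = gab_class R \<F> M I f" "(I, f) \<in> A"
proof -
  have "A \<in> (\<lambda>(I, f). gab_class R \<F> M I f) ` gab_reps R \<F> M"
    using assms by (simp add: gab_module_def)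
  then show thesis
  proof
    fix p assume p: "A = (\<lambda>(I, f). gab_class R \<F> M I f) p" "p \<in> gab_reps R \<F> M"
    obtain I f where "p = (I, f)"
      by (rule prod.exhaust)
    with p have "(I, f) \<in> gab_reps R \<F> M" "A = gab_class R \<F> M I f"
      by simp_all
    then show thesis
      using that[of I f] gab_class_self[of I f] by simp
  qed
qed

lemma gab_carrier_agree:
  assumes A: "A \<in> carrier (gab_module R \<F> M)" and "(J, g) \<in> A" "(J', g') \<in> A"
  shows "\<exists>K\<in>\<F>. K \<subseteq> J \<inter> J' \<and> (\<forall>x\<in>K. g x = g' x)"
proof -
  obtain I f where If: "A = gab_class R \<F> M I f"
    by (rule gab_carrierE[OF A])
  obtain K K' where "K \<in> \<F>" "K \<subseteq> I \<inter> J" "\<forall>x\<in>K. f x = g x"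
    and "K' \<in> \<F>" "K' \<subseteq> I \<inter> J'" "\<forall>x\<in>K'. f x = g' x"
    using gab_classD(2)[OF assms(2)[unfolded If]] gab_classD(2)[OF assms(3)[unfolded If]] by blast
  then show ?thesis
    using F_Int[of K K'] by (intro bexI[of _ "K \<inter> K'"]) auto
qed

lemma gab_carrier_reps:
  assumes "A \<in> carrier (gab_module R \<F> M)" "(J, g) \<in> A"
  shows "(J, g) \<in> gab_reps R \<F> M"
proof -
  obtain I f where "A = gab_class R \<F> M I f"
    by (rule gab_carrierE[OF assms(1)])
  then show ?thesis
    using gab_classD(1) assms(2) by simp
qed

lemma gab_unit_rep:
  assumes m: "m \<in> carrier M"
  shows "(carrier R, \<lambda>r\<in>carrier R. torsion R \<F> M +>\<^bsub>M\<^esub> (r \<odot>\<^bsub>M\<^esub> m)) \<in> gab_reps R \<F> M"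
  using m F_carrier
  by (auto simp: gab_reps_def lin_maps_def quot_carrierI smult_l_distr smult_assoc1
      quot_add[OF torsion_submodule] quot_smult[OF torsion_submodule])

lemma gab_unit_carrier: "m \<in> carrier M \<Longrightarrow> gab_unit R \<F> M m \<in> carrier (gab_module R \<F> M)"
  unfolding gab_unit_def gab_module_def
  using imageI[OF gab_unit_rep[of m], of "\<lambda>(I, f). gab_class R \<F> M I f"] by simp

lemma gab_unit_eqD:
  assumes "m \<in> carrier M" "m' \<in> carrier M" and eq: "gab_unit R \<F> M m = gab_unit R \<F> M m'"
  shows "m \<ominus>\<^bsub>M\<^esub> m' \<in> torsion R \<F> M"
proof -
  let ?f = "\<lambda>m. \<lambda>r\<in>carrier R. torsion R \<F> M +>\<^bsub>M\<^esub> (r \<odot>\<^bsub>M\<^esub> m)"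
  have "(carrier R, ?f m) \<in> gab_class R \<F> M (carrier R) (?f m')"
    using gab_class_self[OF gab_unit_rep[OF assms(1)]] eq by (simp add: gab_unit_def)
  from gab_classD(2)[OF this] obtain K where K: "K \<in> \<F>" "\<And>x. x \<in> K \<Longrightarrow> ?f m' x = ?f m x"
    by blast
  show ?thesis
  proof (rule torsion_local[OF _ K(1)])
    fix x assume x: "x \<in> K"
    then have xR: "x \<in> carrier R"
      using K(1) F_subset by blast
    have "torsion R \<F> M +>\<^bsub>M\<^esub> (x \<odot>\<^bsub>M\<^esub> m) = torsion R \<F> M +>\<^bsub>M\<^esub> (x \<odot>\<^bsub>M\<^esub> m')"
      using K(2)[OF x] xR by simp
    then show "x \<odot>\<^bsub>M\<^esub> (m \<ominus>\<^bsub>M\<^esub> m') \<in> torsion R \<F> M"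
      using assms xR coset_eq_iff[OF torsion_submodule]
      by (simp add: a_minus_def smult_r_distr smult_r_minus)
  qed (use assms in simp)
qed

text \<open>A linear map on \<open>J\<close> into the torsion quotient factors through the image of \<open>J\<close> modulo the
  torsion of \<open>R\<close>: an element of \<open>J\<close> killed by a member of \<open>\<F>\<close> has a torsion value, and
  the torsion quotient is torsion free.\<close>

lemma gab_rep_torsion:
  assumes g: "(J, g) \<in> gab_reps R \<F> M" and b: "b \<in> J" and c: "c \<in> J"
    and bc: "b \<ominus> c \<in> torsion R \<F> (self_module R)"
  shows "g b = g c"
proof -
  note T = torsion_submodule
  have R: "b \<in> carrier R" "c \<in> carrier R"
    using gab_repsD(3)[OF g] b c by auto
  obtain u v where u: "u \<in> carrier M" "g b = torsion R \<F> M +>\<^bsub>M\<^esub> u"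
    and v: "v \<in> carrier M" "g c = torsion R \<F> M +>\<^bsub>M\<^esub> v"
    using gab_repsD(4)[OF g b] gab_repsD(4)[OF g c] by blast
  have "u \<ominus>\<^bsub>M\<^esub> v \<in> torsion R \<F> M"
  proof (rule torsion_local)
    show "annihilator R (self_module R) (b \<ominus> c) \<in> \<F>"
      using bc by (simp add: torsion_def)
    fix r assume "r \<in> annihilator R (self_module R) (b \<ominus> c)"
    then have r: "r \<in> carrier R" and "r \<otimes> (b \<ominus> c) = \<zero>"
      by (auto simp: annihilator_def)
    then have "r \<otimes> b \<oplus> \<ominus> (r \<otimes> c) = \<zero>"
      using R by (simp add: a_minus_def r_distr r_minus)
    from R.minus_equality[OF this] have "r \<otimes> b = r \<otimes> c"
      using r R by simp
    then have "r \<odot>\<^bsub>torsion_quot R \<F> M\<^esub> g b = r \<odot>\<^bsub>torsion_quot R \<F> M\<^esub> g c"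
      using gab_repsD(5)[OF g r] b c by metis
    then show "r \<odot>\<^bsub>M\<^esub> (u \<ominus>\<^bsub>M\<^esub> v) \<in> torsion R \<F> M"
      using r u v coset_eq_iff[OF T]
      by (simp add: quot_smult[OF T] a_minus_def smult_r_distr smult_r_minus)
  qed (use u v in simp)
  then show ?thesis
    using u v coset_eq_iff[OF T] by simp
qed

end

sublocale gabriel_system \<subseteq> self: gabriel_module R \<F> "self_module R"
  by (intro gabriel_module.intro gabriel_system_axioms self_module_is_module)

context gabriel_system
begin

text \<open>Every element \<open>A\<close> of the localization is a fraction: an element \<open>x\<close> in the domain of a
  representative \<open>f\<close> is a denominator of \<open>A\<close>, with numerator any \<open>y\<close> representing \<open>f x\<close>. For \<open>z\<close> in
  a small enough ideal, the unit class of \<open>x\<close> takes \<open>z\<close> to the coset of \<open>z x\<close>, which \<open>f\<close> takes to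
  \<open>z\<close> times \<open>f x\<close>.\<close>

lemma gab_mult_unit:
  assumes A: "A \<in> carrier (gab_ring R \<F>)" and If: "(I, f) \<in> A" and x: "x \<in> I"
    and y: "y \<in> carrier R" and fx: "f x = torsion R \<F> (self_module R) +>\<^bsub>R\<^esub> y"
  shows "gab_mult R \<F> (gab_unit R \<F> (self_module R) x) A = gab_unit R \<F> (self_module R) y"
proof -
  let ?M = "self_module R"
  let ?T = "torsion R \<F> ?M"
  let ?U = "gab_unit R \<F> ?M x"
  let ?K = "\<lambda>I' f' J. {z \<in> I'. f' z \<in> image_in_torsion_quot R \<F> J}"
  have AM: "A \<in> carrier (gab_module R \<F> ?M)"
    using A by (simp add: gab_ring_def)
  note f = self.gab_carrier_reps[OF AM If]
  have xR: "x \<in> carrier R"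
    using self.gab_repsD(3)[OF f] x by blast
  have U_ne: "?U \<noteq> {}"
    using self.gab_class_self[OF self.gab_unit_rep[of x]] xR
    by (auto simp: gab_unit_def)
  have class_eq: "gab_class R \<F> ?M (?K I' f' J) (\<lambda>z\<in>?K I' f' J. factor_through_torsion R \<F> J g (f' z))
      = gab_unit R \<F> ?M y"
    if f': "(I', f') \<in> ?U" and g: "(J, g) \<in> A" for I' f' J g
  proof -
    obtain K1 where K1: "K1 \<in> \<F>" "K1 \<subseteq> I'" "\<And>z. z \<in> K1 \<Longrightarrow> f' z = ?T +>\<^bsub>R\<^esub> (z \<otimes> x)"
    proof -
      obtain K where K: "K \<in> \<F>" "K \<subseteq> carrier R \<inter> I'"
        "\<forall>z\<in>K. (\<lambda>r\<in>carrier R. ?T +>\<^bsub>?M\<^esub> (r \<odot>\<^bsub>?M\<^esub> x)) z = f' z"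
        using self.gab_classD(2)[OF f'[unfolded gab_unit_def]] by blast
      have "f' z = ?T +>\<^bsub>R\<^esub> (z \<otimes> x)" if "z \<in> K" for z
      proof -
        have "z \<in> carrier R"
          using K(2) that by blast
        then show ?thesis
          using bspec[OF K(3) that] by simp
      qed
      then show thesis
        using that[OF K(1)] K(2) by blast
    qed
    obtain K2 where K2: "K2 \<in> \<F>" "K2 \<subseteq> I" "K2 \<subseteq> J" "\<And>z. z \<in> K2 \<Longrightarrow> f z = g z"
      using self.gab_carrier_agree[OF AM If g] by blast
    note gr = self.gab_carrier_reps[OF AM g]
    \<comment> \<open>On \<open>K1\<close> the representative \<open>f'\<close> is multiplication by \<open>x\<close>, and on \<open>K2\<close>
      the representative \<open>g\<close> is \<open>f\<close>; for \<open>z\<close> in both, \<open>z x\<close> still lies in the ideal \<open>K2\<close>.\<close>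
    have L: "K1 \<inter> K2 \<in> \<F>"
      by (rule F_Int[OF K1(1) K2(1)])
    have z: "z \<in> ?K I' f' J \<and> factor_through_torsion R \<F> J g (f' z) = ?T +>\<^bsub>R\<^esub> (z \<otimes> y)"
      if "z \<in> K1 \<inter> K2" for z
    proof -
      have zR: "z \<in> carrier R"
        using that F_subset L by blast
      have zx: "z \<otimes> x \<in> K2"
        using that ideal.I_r_closed[OF F_ideal[OF K2(1)]] xR by blast
      then have zxJ: "z \<otimes> x \<in> J"
        using K2 by blast
      have f'z: "f' z = ?T +>\<^bsub>R\<^esub> (z \<otimes> x)"
        using that K1 by blast
      have "\<zero> \<in> ?T"
        using submodule.axioms(1)[OF self.torsion_submodule] subgroup.one_closed
        by fastforce
      then have "z \<otimes> x \<in> J <+>\<^bsub>R\<^esub> ?T"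
        using zxJ zR xR unfolding set_add_def' by force
      then have 1: "z \<in> ?K I' f' J"
        using that K1(2) f'z by (auto simp: image_in_torsion_quot_def Let_def)
      have "g b = g (z \<otimes> x)" if "b \<in> J" "f' z = ?T +>\<^bsub>R\<^esub> b" for b
      proof (rule self.gab_rep_torsion[OF gr that(1) zxJ])
        have "b \<in> carrier R"
          using self.gab_repsD(3)[OF gr] that by blast
        then show "b \<ominus> z \<otimes> x \<in> ?T"
          using self.coset_eq_iff[OF self.torsion_submodule, of b "z \<otimes> x"] that(2) f'z zR xR
          by simp
      qed
      then have "factor_through_torsion R \<F> J g (f' z) = g (z \<otimes> x)"
        unfolding factor_through_torsion_def
        by (intro the_equality) (use zxJ f'z in metis)+
      also have "\<dots> = f (z \<otimes> x)"
        using K2(4)[OF zx] by simp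
      also have "\<dots> = z \<odot>\<^bsub>torsion_quot R \<F> ?M\<^esub> f x"
        by (rule self.gab_repsD(5)[OF f zR x])
      also have "\<dots> = ?T +>\<^bsub>R\<^esub> (z \<otimes> y)"
        using self.quot_smult[OF self.torsion_submodule zR, of y] y fx by simp
      finally show ?thesis
        using 1 by blast
    qed
    show ?thesis
      unfolding gab_unit_def
    proof (rule self.gab_class_eqI[OF L])
      show "K1 \<inter> K2 \<subseteq> ?K I' f' J \<inter> carrier R"
        using z F_subset[OF L] by blast
      fix z assume zL: "z \<in> K1 \<inter> K2"
      then have "z \<in> carrier R"
        using F_subset[OF L] by blast
      then show "(\<lambda>z\<in>?K I' f' J. factor_through_torsion R \<F> J g (f' z)) z
          = (\<lambda>r\<in>carrier R. ?T +>\<^bsub>?M\<^esub> (r \<odot>\<^bsub>?M\<^esub> y)) z"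
        using z[OF zL] by simp
    qed
  qed
  have "gab_mult R \<F> ?U A = (\<Union>(I', f')\<in>?U. \<Union>(J, g)\<in>A. gab_unit R \<F> ?M y)"
    unfolding gab_mult_def Let_def using class_eq by (intro SUP_cong refl) (auto intro!: SUP_cong)
  then show ?thesis
    using U_ne If by auto
qed

end

section \<open>Tensor products by generators and relations\<close>

lemma r_coset_free_Abelian_group: "K #>\<^bsub>free_Abelian_group X\<^esub> c = (\<lambda>k. k + c) ` K"
  by (auto simp: r_coset_def)

lemma coset_eq_free_Abelian_group_iff:
  assumes K: "subgroup K (free_Abelian_group X)"
  shows "K #>\<^bsub>free_Abelian_group X\<^esub> c = K #>\<^bsub>free_Abelian_group X\<^esub> d \<longleftrightarrow> c - d \<in> K"
proof -
  have zero: "0 \<in> K"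
    using subgroup.one_closed[OF K] by simp
  have add: "a + b \<in> K" if "a \<in> K" "b \<in> K" for a b
    using subgroup.m_closed[OF K that] by simp
  have uminus: "- a \<in> K" if "a \<in> K" for a
    using subgroup.m_inv_closed[OF K that] subgroup.mem_carrier[OF K that] by simp
  have sub: "(\<lambda>k. k + c) ` K \<subseteq> (\<lambda>k. k + d) ` K" if "c - d \<in> K" for c d
  proof
    fix z assume "z \<in> (\<lambda>k. k + c) ` K"
    then obtain k where "k \<in> K" "z = k + c"
      by blast
    then show "z \<in> (\<lambda>k. k + d) ` K"
      using add[OF _ that, of k] by (intro image_eqI[of _ _ "k + (c - d)"]) simp_all
  qed
  show ?thesis
  proof
    assume "K #>\<^bsub>free_Abelian_group X\<^esub> c = K #>\<^bsub>free_Abelian_group X\<^esub> d"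
    moreover have "c \<in> (\<lambda>k. k + c) ` K"
      using zero by (intro image_eqI[of _ _ 0]) simp_all
    ultimately obtain k where "k \<in> K" "c = k + d"
      unfolding r_coset_free_Abelian_group by blast
    then show "c - d \<in> K"
      by simp
  next
    assume "c - d \<in> K"
    then show "K #>\<^bsub>free_Abelian_group X\<^esub> c = K #>\<^bsub>free_Abelian_group X\<^esub> d"
      unfolding r_coset_free_Abelian_group using sub[of c d] sub[of d c] uminus[of "c - d"] by auto
  qed
qed

lemma keys_diff_subset:
  "\<lbrakk>Poly_Mapping.keys a \<subseteq> X; Poly_Mapping.keys b \<subseteq> X\<rbrakk> \<Longrightarrow> Poly_Mapping.keys (a - b) \<subseteq> X"
  for a :: "'a \<Rightarrow>\<^sub>0 int"
  using keys_diff[of a b] by blast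

lemma lin_mapsD:
  assumes "u \<in> lin_maps R M M'"
  shows "x \<in> carrier M \<Longrightarrow> u x \<in> carrier M'"
    and "\<lbrakk>x \<in> carrier M; y \<in> carrier M\<rbrakk> \<Longrightarrow> u (x \<oplus>\<^bsub>M\<^esub> y) = u x \<oplus>\<^bsub>M'\<^esub> u y"
    and "\<lbrakk>r \<in> carrier R; x \<in> carrier M\<rbrakk> \<Longrightarrow> u (r \<odot>\<^bsub>M\<^esub> x) = r \<odot>\<^bsub>M'\<^esub> u x"
  using assms by (auto simp: lin_maps_def)

lemma lin_maps_zero:
  assumes "module R M" "module R M'" and u: "u \<in> lin_maps R M M'"
  shows "u \<zero>\<^bsub>M\<^esub> = \<zero>\<^bsub>M'\<^esub>"
proof -
  interpret M: module R M by fact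
  interpret M': module R M' by fact
  show ?thesis
    using lin_mapsD(3)[OF u, of "\<zero>\<^bsub>R\<^esub>" "\<zero>\<^bsub>M\<^esub>"] lin_mapsD(1)[OF u, of "\<zero>\<^bsub>M\<^esub>"] by simp
qed

text \<open>Elements of the tensor product are handled through representatives in the free abelian
  group: two of them are equal when the difference lies in the subgroup \<open>K\<close> of relations.\<close>

locale tensor_modules = M: module R M + N: module R N for R (structure) and M and N
begin

abbreviation "K \<equiv> tensor_kernel R M N"

lemma tensor_relations_subset: "tensor_relations R M N \<subseteq> carrier (tensor_free M N)"
proof
  fix c assume "c \<in> tensor_relations R M N"
  then have "Poly_Mapping.keys c \<subseteq> carrier M \<times> carrier N"
    unfolding tensor_relations_def
    by (elim UnE CollectE exE conjE) (simp_all add: keys_diff_subset keys_frag_of)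
  then show "c \<in> carrier (tensor_free M N)"
    by (simp add: tensor_free_def)
qed

lemma K_subgroup: "subgroup K (tensor_free M N)"
  unfolding tensor_kernel_def
  by (rule group.generate_is_subgroup[OF _ tensor_relations_subset]) (simp add: tensor_free_def)

lemma K_zero: "0 \<in> K"
  using subgroup.one_closed[OF K_subgroup] by (simp add: tensor_free_def)

lemma K_keys: "c \<in> K \<Longrightarrow> Poly_Mapping.keys c \<subseteq> carrier M \<times> carrier N"
  using subgroup.mem_carrier[OF K_subgroup, of c] by (simp add: tensor_free_def)

lemma K_uminus: "c \<in> K \<Longrightarrow> - c \<in> K"
  using subgroup.m_inv_closed[OF K_subgroup, of c] K_keys[of c] by (simp add: tensor_free_def)

lemma K_add: "c \<in> K \<Longrightarrow> d \<in> K \<Longrightarrow> c + d \<in> K"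
  using subgroup.m_closed[OF K_subgroup, of c d] by (simp add: tensor_free_def)

lemma K_diff: "c \<in> K \<Longrightarrow> d \<in> K \<Longrightarrow> c - d \<in> K"
  using K_add[OF _ K_uminus, of c d] by simp

lemma K_add_left:
  "\<lbrakk>x \<in> carrier M; x' \<in> carrier M; y \<in> carrier N\<rbrakk>
    \<Longrightarrow> frag_of (x \<oplus>\<^bsub>M\<^esub> x', y) - frag_of (x, y) - frag_of (x', y) \<in> K"
  unfolding tensor_kernel_def tensor_relations_def by (rule generate.incl) blast

lemma K_add_right:
  "\<lbrakk>x \<in> carrier M; y \<in> carrier N; y' \<in> carrier N\<rbrakk>
    \<Longrightarrow> frag_of (x, y \<oplus>\<^bsub>N\<^esub> y') - frag_of (x, y) - frag_of (x, y') \<in> K"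
  unfolding tensor_kernel_def tensor_relations_def by (rule generate.incl) blast

lemma K_smult:
  "\<lbrakk>r \<in> carrier R; x \<in> carrier M; y \<in> carrier N\<rbrakk>
    \<Longrightarrow> frag_of (r \<odot>\<^bsub>M\<^esub> x, y) - frag_of (x, r \<odot>\<^bsub>N\<^esub> y) \<in> K"
  unfolding tensor_kernel_def tensor_relations_def by (rule generate.incl) blast

lemma K_zero_left: "y \<in> carrier N \<Longrightarrow> frag_of (\<zero>\<^bsub>M\<^esub>, y) \<in> K"
  using K_uminus[OF K_add_left[of "\<zero>\<^bsub>M\<^esub>" "\<zero>\<^bsub>M\<^esub>" y]] by simp

lemma K_induct [consumes 1, case_names zero diff add_left add_right smult]:
  assumes c: "c \<in> K"
    and zero: "P 0"
    and diff: "\<And>a b. \<lbrakk>Poly_Mapping.keys a \<subseteq> carrier M \<times> carrier N;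
      Poly_Mapping.keys b \<subseteq> carrier M \<times> carrier N; P a; P b\<rbrakk> \<Longrightarrow> P (a - b)"
    and add_left: "\<And>x x' y. \<lbrakk>x \<in> carrier M; x' \<in> carrier M; y \<in> carrier N\<rbrakk>
      \<Longrightarrow> P (frag_of (x \<oplus>\<^bsub>M\<^esub> x', y) - frag_of (x, y) - frag_of (x', y))"
    and add_right: "\<And>x y y'. \<lbrakk>x \<in> carrier M; y \<in> carrier N; y' \<in> carrier N\<rbrakk>
      \<Longrightarrow> P (frag_of (x, y \<oplus>\<^bsub>N\<^esub> y') - frag_of (x, y) - frag_of (x, y'))"
    and smult: "\<And>r x y. \<lbrakk>r \<in> carrier R; x \<in> carrier M; y \<in> carrier N\<rbrakk>
      \<Longrightarrow> P (frag_of (r \<odot>\<^bsub>M\<^esub> x, y) - frag_of (x, r \<odot>\<^bsub>N\<^esub> y))"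
  shows "P c"
proof -
  let ?X = "carrier M \<times> carrier N"
  let ?H = "{c. Poly_Mapping.keys c \<subseteq> ?X \<and> P c}"
  have uminus: "- a \<in> ?H" if "a \<in> ?H" for a
    using diff[of 0 a] zero that by simp
  have "subgroup ?H (tensor_free M N)"
    unfolding tensor_free_def
  proof (rule group.subgroupI[OF group_free_Abelian_group])
    show "?H \<subseteq> carrier (free_Abelian_group ?X)"
      by auto
    show "?H \<noteq> {}"
      using zero by (auto intro: exI[of _ 0])
    show "inv\<^bsub>free_Abelian_group ?X\<^esub> a \<in> ?H" if "a \<in> ?H" for a
      using uminus[OF that] that by simp
    show "a \<otimes>\<^bsub>free_Abelian_group ?X\<^esub> b \<in> ?H" if "a \<in> ?H" "b \<in> ?H" for a b
      using diff[of a "- b"] uminus[OF that(2)] that keys_diff_subset[of a ?X "- b"] by simp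
  qed
  moreover have "tensor_relations R M N \<subseteq> ?H"
  proof -
    have "Poly_Mapping.keys c \<subseteq> ?X" if "c \<in> tensor_relations R M N" for c
      using subsetD[OF tensor_relations_subset that] by (simp add: tensor_free_def)
    moreover have "P c" if "c \<in> tensor_relations R M N" for c
      using that unfolding tensor_relations_def
      by (elim UnE CollectE exE conjE) (simp_all only: add_left add_right smult)
    ultimately show ?thesis
      by blast
  qed
  ultimately have "K \<subseteq> ?H"
    unfolding tensor_kernel_def
    by (intro group.generate_subgroup_incl) (simp_all add: tensor_free_def)
  then show ?thesis
    using c by blast
qed

end

lemma keys_frag_extend_subset:
  assumes "Poly_Mapping.keys c \<subseteq> Y" "\<And>p. p \<in> Y \<Longrightarrow> Poly_Mapping.keys (f p) \<subseteq> X"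
  shows "Poly_Mapping.keys (frag_extend f c) \<subseteq> X"
  by (rule subset_trans[OF keys_frag_extend]) (use assms in blast)

text \<open>The map induced by \<open>u\<close> is well defined on cosets because \<open>u\<close>, extended linearly to formal sums,
  takes relations to relations. Being additive, it is injective as soon as only relations go to
  relations.\<close>

lemma tensor_map_inj_on:
  fixes u
  assumes "module R M" "module R M'" "module R N" and u: "u \<in> lin_maps R M M'"
    and reflects: "\<And>c. \<lbrakk>Poly_Mapping.keys c \<subseteq> carrier M \<times> carrier N;
        frag_extend (\<lambda>(x, y). frag_of (u x, y)) c \<in> tensor_kernel R M' N\<rbrakk> \<Longrightarrow> c \<in> tensor_kernel R M N"
  shows "inj_on (tensor_map R M' N u) (carrier (tensor R M N))"
proof
  interpret M: tensor_modules R M N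
    by (intro tensor_modules.intro assms)
  interpret M': tensor_modules R M' N
    by (intro tensor_modules.intro assms)
  let ?U = "frag_extend (\<lambda>(x, y). frag_of (u x, y))"
  let ?coset = "\<lambda>c. M.K #>\<^bsub>tensor_free M N\<^esub> c"
  let ?coset' = "\<lambda>c. M'.K #>\<^bsub>tensor_free M' N\<^esub> c"
  note u_simps = lin_mapsD[OF u]
  note coset_eq = coset_eq_free_Abelian_group_iff[OF M.K_subgroup[unfolded tensor_free_def], folded tensor_free_def]
  note coset'_eq = coset_eq_free_Abelian_group_iff[OF M'.K_subgroup[unfolded tensor_free_def], folded tensor_free_def]
  have U_kernel: "?U c \<in> M'.K" if "c \<in> M.K" for c
    using that
  proof (induction rule: M.K_induct)
    case zero
    then show ?case
      by (simp add: M'.K_zero)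
  qed (auto simp: frag_extend_diff u_simps
        intro: M'.K_diff M'.K_add_left M'.K_add_right M'.K_smult)
  have map_coset: "tensor_map R M' N u (?coset c) = ?coset' (?U c)" for c
  proof -
    have "(\<exists>d\<in>?coset c. Y = ?coset' (?U d)) \<longleftrightarrow> Y = ?coset' (?U c)" for Y
    proof -
      have "?coset' (?U d) = ?coset' (?U c)" if "d \<in> ?coset c" for d
      proof -
        have "d - c \<in> M.K"
          using that by (auto simp: tensor_free_def r_coset_free_Abelian_group)
        then show ?thesis
          using U_kernel[of "d - c"] coset'_eq by (simp add: frag_extend_diff)
      qed
      moreover have "c \<in> ?coset c"
        using M.K_zero by (auto simp: tensor_free_def r_coset_free_Abelian_group image_iff intro: bexI[of _ 0])
      ultimately show ?thesis
        by metis
    qed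
    then show ?thesis
      unfolding tensor_map_def by simp
  qed
  fix X Y
  assume X: "X \<in> carrier (tensor R M N)" and Y: "Y \<in> carrier (tensor R M N)"
    and eq: "tensor_map R M' N u X = tensor_map R M' N u Y"
  from X Y obtain c d where c: "c \<in> carrier (tensor_free M N)" "X = ?coset c"
    and d: "d \<in> carrier (tensor_free M N)" "Y = ?coset d"
    by (auto simp: tensor_def FactGroup_def RCOSETS_def)
  have "?U (c - d) \<in> M'.K"
    using eq c d coset'_eq by (simp add: map_coset frag_extend_diff)
  moreover have "Poly_Mapping.keys (c - d) \<subseteq> carrier M \<times> carrier N"
    using c d keys_diff[of c d] by (auto simp: tensor_free_def)
  ultimately show "X = Y"
    using reflects[of "c - d"] coset_eq c d by simp
qed

section \<open>Ring maps sending the system to the unit ideal\<close>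

lemma restrict_scalars_sel [simp]:
  "carrier (restrict_scalars \<phi> S) = carrier S" "\<zero>\<^bsub>restrict_scalars \<phi> S\<^esub> = \<zero>\<^bsub>S\<^esub>"
  "x \<oplus>\<^bsub>restrict_scalars \<phi> S\<^esub> y = x \<oplus>\<^bsub>S\<^esub> y" "r \<odot>\<^bsub>restrict_scalars \<phi> S\<^esub> x = \<phi> r \<otimes>\<^bsub>S\<^esub> x"
  by (simp_all add: restrict_scalars_def)

lemma a_minus_restrict_scalars [simp]: "x \<ominus>\<^bsub>restrict_scalars \<phi> S\<^esub> y = x \<ominus>\<^bsub>S\<^esub> y"
  by (simp add: a_minus_def a_inv_def m_inv_def)

lemma restrict_scalars_is_module:
  assumes "cring R" "cring S" and hom: "\<phi> \<in> ring_hom R S"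
  shows "module R (restrict_scalars \<phi> S)"
proof -
  interpret R: cring R by fact
  interpret S: cring S by fact
  interpret \<phi>: ring_hom_cring R S \<phi>
    by unfold_locales (rule hom)
  have "abelian_group (restrict_scalars \<phi> S)"
  proof (rule abelian_groupI)
    fix x assume "x \<in> carrier (restrict_scalars \<phi> S)"
    then show "\<exists>y\<in>carrier (restrict_scalars \<phi> S).
        y \<oplus>\<^bsub>restrict_scalars \<phi> S\<^esub> x = \<zero>\<^bsub>restrict_scalars \<phi> S\<^esub>"
      by (intro bexI[of _ "\<ominus>\<^bsub>S\<^esub> x"]) (auto simp: S.l_neg)
  qed (auto simp: S.a_ac)
  then show ?thesis
    by (rule moduleI[OF R.cring_axioms]) (auto simp: S.l_distr S.r_distr S.m_assoc)
qed

locale gabriel_expanding = gabriel_system R \<F> + S?: cring S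
  for R (structure) and \<F> and S (structure) +
  fixes \<phi>
  assumes hom: "\<phi> \<in> ring_hom R S"
    and expand: "I \<in> \<F> \<Longrightarrow> Idl\<^bsub>S\<^esub> (\<phi> ` I) = carrier S"
begin

sublocale \<phi>: ring_hom_cring R S \<phi>
  by unfold_locales (rule hom)

sublocale SM: gabriel_module R \<F> "restrict_scalars \<phi> S"
  by (intro gabriel_module.intro gabriel_system_axioms restrict_scalars_is_module hom
      R.cring_axioms S.cring_axioms)

text \<open>The form in which \<open>I S = S\<close> is used: a property of elements of \<open>S\<close> that cuts out an ideal holds
  for 1 as soon as it holds on \<open>\<phi>(I)\<close>.\<close>

lemma ideal_eq_carrier:
  assumes "I \<in> \<F>" "ideal A S" "\<phi> ` I \<subseteq> A"
  shows "A = carrier S"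
proof
  show "A \<subseteq> carrier S"
    by (rule additive_subgroup.a_subset[OF ideal.axioms(1)[OF assms(2)]])
  show "carrier S \<subseteq> A"
    using S.genideal_minimal[OF assms(2,3)] expand[OF assms(1)] by simp
qed

text \<open>The annihilator of \<open>s\<close> in \<open>S\<close> is an ideal that contains \<open>\<phi>(I)\<close>, hence contains 1.\<close>

lemma S_torsion_free:
  assumes I: "I \<in> \<F>" and s: "s \<in> carrier S" and kill: "\<And>x. x \<in> I \<Longrightarrow> \<phi> x \<otimes>\<^bsub>S\<^esub> s = \<zero>\<^bsub>S\<^esub>"
  shows "s = \<zero>\<^bsub>S\<^esub>"
proof -
  interpret SS: module S "self_module S"
    by (rule S.self_module_is_module)
  have "annihilator S (self_module S) s = carrier S"
  proof (rule ideal_eq_carrier[OF I])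
    show "ideal (annihilator S (self_module S) s) S"
      using SS.annihilator_ideal[of s] s by simp
    show "\<phi> ` I \<subseteq> annihilator S (self_module S) s"
      using kill F_subset[OF I] by (auto simp: annihilator_def)
  qed
  then have "\<one>\<^bsub>S\<^esub> \<in> annihilator S (self_module S) s"
    by simp
  then show ?thesis
    using s by (simp add: annihilator_def)
qed

lemma torsion_restrict_scalars: "torsion R \<F> (restrict_scalars \<phi> S) = {\<zero>\<^bsub>S\<^esub>}"
proof -
  have "s = \<zero>\<^bsub>S\<^esub>" if "s \<in> torsion R \<F> (restrict_scalars \<phi> S)" for s
  proof (rule S_torsion_free)
    show "annihilator R (restrict_scalars \<phi> S) s \<in> \<F>"
      using that by (simp add: torsion_def)
  qed (use that in \<open>auto simp: torsion_def annihilator_def\<close>)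
  moreover have "\<zero>\<^bsub>S\<^esub> \<in> torsion R \<F> (restrict_scalars \<phi> S)"
    using subgroup.one_closed[OF submodule.axioms(1)[OF SM.torsion_submodule]] by simp
  ultimately show ?thesis
    by blast
qed

lemma hom_torsion:
  assumes t: "t \<in> torsion R \<F> (self_module R)"
  shows "\<phi> t = \<zero>\<^bsub>S\<^esub>"
proof -
  have "t \<in> carrier R"
    using t by (simp add: torsion_def)
  then show ?thesis
    using SM.smult_torsion_closed[OF t, of "\<one>\<^bsub>S\<^esub>"] torsion_restrict_scalars by simp
qed

lemma gab_unit_inj: "inj_on (gab_unit R \<F> (restrict_scalars \<phi> S)) (carrier S)"
proof
  fix s s' assume s: "s \<in> carrier S" "s' \<in> carrier S"
    and "gab_unit R \<F> (restrict_scalars \<phi> S) s = gab_unit R \<F> (restrict_scalars \<phi> S) s'"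
  then have "s \<ominus>\<^bsub>S\<^esub> s' = \<zero>\<^bsub>S\<^esub>"
    using SM.gab_unit_eqD[of s s'] torsion_restrict_scalars by simp
  then show "s = s'"
    using s S.minus_equality[of s "\<ominus>\<^bsub>S\<^esub> s'"] by (simp add: a_minus_def)
qed

lemma torsion_quot_map_coset:
  assumes y: "y \<in> carrier R"
  shows "torsion_quot_map R \<F> (restrict_scalars \<phi> S) \<phi> (torsion R \<F> (self_module R) +>\<^bsub>R\<^esub> y)
    = torsion R \<F> (restrict_scalars \<phi> S) +>\<^bsub>S\<^esub> \<phi> y"
proof -
  let ?T = "torsion R \<F> (self_module R)"
  have coset: "N +>\<^bsub>restrict_scalars \<phi> S\<^esub> s = N +>\<^bsub>S\<^esub> s" for N s
    by (simp add: a_r_coset_def')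
  have "\<phi> m = \<phi> y" if m: "m \<in> ?T +>\<^bsub>R\<^esub> y" for m
  proof -
    obtain t where t: "t \<in> ?T" "m = t \<oplus> y"
      using m by (auto simp: a_r_coset_def')
    then have "t \<in> carrier R"
      by (simp add: torsion_def)
    then show ?thesis
      using t y hom_torsion[OF t(1)] by simp
  qed
  moreover have "y \<in> ?T +>\<^bsub>R\<^esub> y"
    using abelian_subgroup.a_rcos_self[OF self.submodule_imp_abelian_subgroup[OF self.torsion_submodule], of y] y
    by simp
  ultimately have "(\<exists>m\<in>?T +>\<^bsub>R\<^esub> y. Y = torsion R \<F> (restrict_scalars \<phi> S) +>\<^bsub>S\<^esub> \<phi> m)
      \<longleftrightarrow> Y = torsion R \<F> (restrict_scalars \<phi> S) +>\<^bsub>S\<^esub> \<phi> y" for Y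
    by metis
  then show ?thesis
    unfolding torsion_quot_map_def coset by simp
qed

text \<open>The equations on \<open>s\<close> say that \<open>s\<close> is the value of the fraction \<open>A\<close> in \<open>S\<close>. On the domain \<open>I\<close> of a
  representative \<open>f\<close>, both sides then take \<open>x\<close> to the class of \<open>\<phi> x \<cdot> s\<close>.\<close>

lemma gab_map_eq_unit:
  assumes A: "A \<in> carrier (gab_ring R \<F>)" and s: "s \<in> carrier S"
    and eq: "\<And>I f x y. \<lbrakk>(I, f) \<in> A; x \<in> I; y \<in> carrier R; f x = torsion R \<F> (self_module R) +>\<^bsub>R\<^esub> y\<rbrakk>
        \<Longrightarrow> \<phi> x \<otimes>\<^bsub>S\<^esub> s = \<phi> y"
  shows "gab_map R \<F> (restrict_scalars \<phi> S) \<phi> A = gab_unit R \<F> (restrict_scalars \<phi> S) s"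
proof -
  let ?M = "restrict_scalars \<phi> S"
  have AM: "A \<in> carrier (gab_module R \<F> (self_module R))"
    using A by (simp add: gab_ring_def)
  have "gab_class R \<F> ?M I (\<lambda>x\<in>I. torsion_quot_map R \<F> ?M \<phi> (f x)) = gab_unit R \<F> ?M s"
    if If: "(I, f) \<in> A" for I f
    unfolding gab_unit_def
  proof (rule SM.gab_class_eqI)
    note f = self.gab_carrier_reps[OF AM If]
    show "I \<in> \<F>" "I \<subseteq> I \<inter> carrier R"
      using self.gab_repsD(1,3)[OF f] by auto
    fix x assume x: "x \<in> I"
    then have xR: "x \<in> carrier R"
      using self.gab_repsD(3)[OF f] by blast
    obtain y where y: "y \<in> carrier R" "f x = torsion R \<F> (self_module R) +>\<^bsub>R\<^esub> y"
      using self.gab_repsD(4)[OF f x] by auto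
    show "(\<lambda>x\<in>I. torsion_quot_map R \<F> ?M \<phi> (f x)) x
        = (\<lambda>r\<in>carrier R. torsion R \<F> ?M +>\<^bsub>?M\<^esub> (r \<odot>\<^bsub>?M\<^esub> s)) x"
      using x xR y eq[OF If x y] torsion_quot_map_coset[OF y(1)] by (simp add: a_r_coset_def')
  qed
  moreover have "A \<noteq> {}"
    using self.gab_carrierE[OF AM] by blast
  ultimately show ?thesis
    unfolding gab_map_def by (auto simp: SUP_constant split: prod.splits)
qed

end

section \<open>Ring maps with torsion kernel and denominators\<close>

text \<open>What is needed of an isomorphism of \<open>S\<close> with the localization: elements of \<open>S\<close> are fractions
  of elements of \<open>R\<close>, with numerators unique up to torsion.\<close>

locale gabriel_fractions = gabriel_expanding +
  assumes kernel_torsion: "\<lbrakk>r \<in> carrier R; \<phi> r = \<zero>\<^bsub>S\<^esub>\<rbrakk> \<Longrightarrow> r \<in> torsion R \<F> (self_module R)"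
    and denominators: "s \<in> carrier S \<Longrightarrow> \<exists>I\<in>\<F>. \<forall>x\<in>I. \<exists>y\<in>carrier R. \<phi> x \<otimes>\<^bsub>S\<^esub> s = \<phi> y"
begin

text \<open>The \<open>t\<close> with \<open>g s \<cdot> h t = h s \<cdot> h t\<close> form an ideal of \<open>S\<close>. It contains \<open>\<phi> x\<close> for every denominator
  \<open>x\<close> of \<open>s\<close>, as \<open>g s \<cdot> h (\<phi> x) = g (s \<cdot> \<phi> x) = h (s \<cdot> \<phi> x) = h s \<cdot> h (\<phi> x)\<close>; so it contains 1.\<close>

lemma epimorphism:
  fixes T :: "'t ring"
  assumes T: "cring T" and g: "g \<in> ring_hom S T" and h: "h \<in> ring_hom S T"
    and eq: "\<And>r. r \<in> carrier R \<Longrightarrow> g (\<phi> r) = h (\<phi> r)" and s: "s \<in> carrier S"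
  shows "g s = h s"
proof -
  interpret T: cring T by fact
  interpret g: ring_hom_cring S T g by unfold_locales (rule g)
  interpret h: ring_hom_cring S T h by unfold_locales (rule h)
  obtain I where I: "I \<in> \<F>" and den: "\<And>x. x \<in> I \<Longrightarrow> \<exists>y\<in>carrier R. \<phi> x \<otimes>\<^bsub>S\<^esub> s = \<phi> y"
    using denominators[OF s] by blast
  let ?A = "{t \<in> carrier S. g s \<otimes>\<^bsub>T\<^esub> h t = h s \<otimes>\<^bsub>T\<^esub> h t}"
  have "?A = carrier S"
  proof (rule ideal_eq_carrier[OF I])
    show "ideal ?A S"
    proof (rule idealI[OF S.ring_axioms])
      show "subgroup ?A (add_monoid S)"
      proof (rule S.add.subgroupI)
        show "?A \<noteq> {}"
          using s by (auto intro!: exI[of _ "\<zero>\<^bsub>S\<^esub>"])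
      qed (use s in \<open>auto simp: T.r_distr T.r_minus\<close>)
    next
      fix a t assume a: "a \<in> ?A" and t: "t \<in> carrier S"
      then show "a \<otimes>\<^bsub>S\<^esub> t \<in> ?A"
        using s by (simp flip: T.m_assoc)
      then show "t \<otimes>\<^bsub>S\<^esub> a \<in> ?A"
        using a t by (simp add: S.m_comm)
    qed
    show "\<phi> ` I \<subseteq> ?A"
    proof
      fix t assume "t \<in> \<phi> ` I"
      then obtain x where x: "x \<in> I" "t = \<phi> x"
        by blast
      then have xR: "x \<in> carrier R"
        using F_subset[OF I] by blast
      obtain y where y: "y \<in> carrier R" "\<phi> x \<otimes>\<^bsub>S\<^esub> s = \<phi> y"
        using den[OF x(1)] by blast
      have "g s \<otimes>\<^bsub>T\<^esub> h (\<phi> x) = g (\<phi> x \<otimes>\<^bsub>S\<^esub> s)"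
        using xR s by (simp add: T.m_comm flip: eq)
      also have "\<dots> = h (\<phi> x \<otimes>\<^bsub>S\<^esub> s)"
        using y eq by simp
      also have "\<dots> = h s \<otimes>\<^bsub>T\<^esub> h (\<phi> x)"
        using xR s by (simp add: T.m_comm)
      finally show "t \<in> ?A"
        using x xR by simp
    qed
  qed
  then have "\<one>\<^bsub>S\<^esub> \<in> ?A"
    by simp
  then show ?thesis
    using s by simp
qed

text \<open>A numerator of \<open>s\<close> over the denominator \<open>x\<close>, unique only up to torsion. The value 0 when \<open>x\<close> is
  not a denominator keeps it in \<open>R\<close> for all arguments, so that \<open>clear_denom\<close> below is a
  homomorphism on the whole free group for every \<open>x\<close>.\<close>

definition numerator where
  "numerator x s = (if \<exists>y\<in>carrier R. \<phi> x \<otimes>\<^bsub>S\<^esub> s = \<phi> y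
     then (SOME y. y \<in> carrier R \<and> \<phi> x \<otimes>\<^bsub>S\<^esub> s = \<phi> y) else \<zero>\<^bsub>R\<^esub>)"

lemma numerator_closed: "numerator x s \<in> carrier R"
  unfolding numerator_def by (auto intro: someI2_bex[where Q = "\<lambda>y. y \<in> carrier R"])

lemma ex_numerator: "s \<in> carrier S \<Longrightarrow> \<exists>I\<in>\<F>. \<forall>x\<in>I. \<phi> (numerator x s) = \<phi> x \<otimes>\<^bsub>S\<^esub> s"
proof -
  assume "s \<in> carrier S"
  then obtain I where I: "I \<in> \<F>" "\<And>x. x \<in> I \<Longrightarrow> \<exists>y\<in>carrier R. \<phi> x \<otimes>\<^bsub>S\<^esub> s = \<phi> y"
    using denominators by blast
  have "\<phi> (numerator x s) = \<phi> x \<otimes>\<^bsub>S\<^esub> s" if "x \<in> I" for x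
    using I(2)[OF that] unfolding numerator_def
    by simp (rule someI2_ex[where Q = "\<lambda>y. \<phi> y = \<phi> x \<otimes>\<^bsub>S\<^esub> s"], auto)
  then show ?thesis
    using I(1) by blast
qed

text \<open>The homomorphism on formal sums that sends \<open>(m, s)\<close> to \<open>numerator x s \<cdot> m\<close>. When \<open>x\<close> is a
  denominator of all ring elements occurring in \<open>w\<close>, it yields an element \<open>m\<close> of \<open>M\<close> for which
  \<open>x w\<close> and \<open>m \<otimes> 1\<close> are equal in the tensor product.\<close>

definition clear_denom where
  "clear_denom M x = (SOME h. h \<in> hom (tensor_free M (restrict_scalars \<phi> S)) (add_monoid M) \<and>
     (\<forall>m\<in>carrier M. \<forall>s\<in>carrier S. h (frag_of (m, s)) = numerator x s \<odot>\<^bsub>M\<^esub> m))"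

lemma clear_denom_spec:
  assumes "module R M"
  shows "clear_denom M x \<in> hom (tensor_free M (restrict_scalars \<phi> S)) (add_monoid M)"
    and "\<lbrakk>m \<in> carrier M; s \<in> carrier S\<rbrakk> \<Longrightarrow> clear_denom M x (frag_of (m, s)) = numerator x s \<odot>\<^bsub>M\<^esub> m"
proof -
  interpret M: module R M by fact
  have gens: "(\<lambda>(m, s). numerator x s \<odot>\<^bsub>M\<^esub> m) ` (carrier M \<times> carrier S) \<subseteq> carrier (add_monoid M)"
    by (auto simp: numerator_closed)
  have "\<exists>h. h \<in> hom (tensor_free M (restrict_scalars \<phi> S)) (add_monoid M) \<and>
     (\<forall>m\<in>carrier M. \<forall>s\<in>carrier S. h (frag_of (m, s)) = numerator x s \<odot>\<^bsub>M\<^esub> m)"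
  proof (rule comm_group.free_Abelian_group_universal[OF M.a_comm_group gens])
    fix h assume "h \<in> hom (free_Abelian_group (carrier M \<times> carrier S)) (add_monoid M)"
      and "\<And>p. p \<in> carrier M \<times> carrier S \<Longrightarrow> h (frag_of p) = (\<lambda>(m, s). numerator x s \<odot>\<^bsub>M\<^esub> m) p"
    then show ?thesis
      by (intro exI[of _ h]) (simp add: tensor_free_def)
  qed
  from someI_ex[OF this]
  show "clear_denom M x \<in> hom (tensor_free M (restrict_scalars \<phi> S)) (add_monoid M)"
    and "\<lbrakk>m \<in> carrier M; s \<in> carrier S\<rbrakk> \<Longrightarrow> clear_denom M x (frag_of (m, s)) = numerator x s \<odot>\<^bsub>M\<^esub> m"
    unfolding clear_denom_def by blast+
qed

lemma clear_denom_closed: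
  assumes "module R M" "Poly_Mapping.keys w \<subseteq> carrier M \<times> carrier S"
  shows "clear_denom M x w \<in> carrier M"
  using hom_in_carrier[OF clear_denom_spec(1)[OF assms(1)], of w x] assms(2) by (simp add: tensor_free_def)

lemma clear_denom_zero:
  assumes "module R M"
  shows "clear_denom M x 0 = \<zero>\<^bsub>M\<^esub>"
proof -
  interpret M: module R M by fact
  show ?thesis
    using hom_one[OF clear_denom_spec(1)[OF assms, of x]] M.add.is_group
    by (simp add: tensor_free_def)
qed

lemma clear_denom_diff:
  assumes M: "module R M" and a: "Poly_Mapping.keys a \<subseteq> carrier M \<times> carrier S"
    and b: "Poly_Mapping.keys b \<subseteq> carrier M \<times> carrier S"
  shows "clear_denom M x (a - b) = clear_denom M x a \<ominus>\<^bsub>M\<^esub> clear_denom M x b"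
proof -
  interpret M: module R M by fact
  have ab: "Poly_Mapping.keys (a - b) \<subseteq> carrier M \<times> carrier S"
    by (rule keys_diff_subset[OF a b])
  have "clear_denom M x ((a - b) + b) = clear_denom M x (a - b) \<oplus>\<^bsub>M\<^esub> clear_denom M x b"
    using hom_mult[OF clear_denom_spec(1)[OF M], of "a - b" b x] ab b by (simp add: tensor_free_def)
  then show ?thesis
    using clear_denom_closed[OF M] a b ab by (simp add: a_minus_def M.a_assoc M.r_neg)
qed

text \<open>Numerators are unique up to torsion, hence so are the values of \<open>clear_denom\<close>.\<close>

lemma smult_diff_torsion:
  assumes M: "module R M" and "a \<in> carrier R" "b \<in> carrier R" "\<phi> a = \<phi> b" and "m \<in> carrier M"
  shows "a \<odot>\<^bsub>M\<^esub> m \<ominus>\<^bsub>M\<^esub> b \<odot>\<^bsub>M\<^esub> m \<in> torsion R \<F> M"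
proof -
  interpret M: gabriel_module R \<F> M
    by (intro gabriel_module.intro gabriel_system_axioms M)
  have "a \<ominus>\<^bsub>R\<^esub> b \<in> torsion R \<F> (self_module R)"
    using assms by (intro kernel_torsion) (simp_all add: a_minus_def S.r_neg)
  from M.smult_torsion_closed[OF this assms(5)] show ?thesis
    using assms by (simp add: a_minus_def M.smult_l_distr M.smult_l_minus)
qed

text \<open>Modulo torsion, \<open>(m, s) \<mapsto> numerator x s \<cdot> m\<close> is bilinear and balanced once \<open>x\<close> is a denominator
  of the finitely many ring elements involved in a relation. The ideal \<open>I\<close> depends on \<open>c\<close>, and
  each step of the induction over relations shrinks it by finite intersections.\<close>

lemma clear_denom_kernel_torsion:
  assumes M: "module R M" and c: "c \<in> tensor_kernel R M (restrict_scalars \<phi> S)"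
  shows "\<exists>I\<in>\<F>. \<forall>x\<in>I. clear_denom M x c \<in> torsion R \<F> M"
proof -
  interpret M: gabriel_module R \<F> M
    by (intro gabriel_module.intro gabriel_system_axioms M)
  interpret TM: tensor_modules R M "restrict_scalars \<phi> S"
    by (intro tensor_modules.intro M SM.module_axioms)
  note T = M.submoduleE[OF M.torsion_submodule]
  have T0: "\<zero>\<^bsub>M\<^esub> \<in> torsion R \<F> M"
    using subgroup.one_closed[OF submodule.axioms(1)[OF M.torsion_submodule]] by simp
  show ?thesis
    using c
  proof (induction rule: TM.K_induct)
    case zero
    then show ?case
      using F_carrier T0 by (auto simp: clear_denom_zero[OF M])
  next
    case (diff a b)
    then obtain I J where I: "I \<in> \<F>" "\<forall>x\<in>I. clear_denom M x a \<in> torsion R \<F> M"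
      and J: "J \<in> \<F>" "\<forall>x\<in>J. clear_denom M x b \<in> torsion R \<F> M"
      by blast
    have "clear_denom M x (a - b) \<in> torsion R \<F> M" if "x \<in> I \<inter> J" for x
      using that I J T(3,5) diff.hyps clear_denom_diff[OF M, of a b x] by (simp add: a_minus_def)
    then show ?case
      using F_Int[OF I(1) J(1)] by blast
  next
    case (add_left m m' s)
    then have "clear_denom M x (frag_of (m \<oplus>\<^bsub>M\<^esub> m', s) - frag_of (m, s) - frag_of (m', s)) = \<zero>\<^bsub>M\<^esub>" for x
      by (simp add: clear_denom_diff[OF M] clear_denom_spec(2)[OF M] keys_diff_subset keys_frag_of numerator_closed
          M.smult_r_distr a_minus_def M.a_ac M.M.r_neg M.M.r_neg1 M.M.r_neg2)
    then show ?case
      using F_carrier T0 by auto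
  next
    case (add_right m s s')
    then have s: "s \<in> carrier S" "s' \<in> carrier S" and m: "m \<in> carrier M"
      by simp_all
    obtain I I' J where I: "I \<in> \<F>" "\<forall>x\<in>I. \<phi> (numerator x s) = \<phi> x \<otimes>\<^bsub>S\<^esub> s"
      and I': "I' \<in> \<F>" "\<forall>x\<in>I'. \<phi> (numerator x s') = \<phi> x \<otimes>\<^bsub>S\<^esub> s'"
      and J: "J \<in> \<F>" "\<forall>x\<in>J. \<phi> (numerator x (s \<oplus>\<^bsub>S\<^esub> s')) = \<phi> x \<otimes>\<^bsub>S\<^esub> (s \<oplus>\<^bsub>S\<^esub> s')"
      using ex_numerator[of s] ex_numerator[of s'] ex_numerator[of "s \<oplus>\<^bsub>S\<^esub> s'"] s by blast
    have L: "I \<inter> I' \<inter> J \<in> \<F>"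
      by (intro F_Int I J I')
    have "clear_denom M x (frag_of (m, s \<oplus>\<^bsub>S\<^esub> s') - frag_of (m, s) - frag_of (m, s')) \<in> torsion R \<F> M"
      if x: "x \<in> I \<inter> I' \<inter> J" for x
    proof -
      have "x \<in> carrier R"
        using F_subset[OF L] x by blast
      then have "\<phi> (numerator x (s \<oplus>\<^bsub>S\<^esub> s')) = \<phi> (numerator x s \<oplus>\<^bsub>R\<^esub> numerator x s')"
        using x I I' J s by (simp add: numerator_closed S.r_distr)
      then have "numerator x (s \<oplus>\<^bsub>S\<^esub> s') \<odot>\<^bsub>M\<^esub> m \<ominus>\<^bsub>M\<^esub> (numerator x s \<oplus>\<^bsub>R\<^esub> numerator x s') \<odot>\<^bsub>M\<^esub> m \<in> torsion R \<F> M"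
        using m by (intro smult_diff_torsion[OF M]) (simp_all add: numerator_closed)
      moreover have "clear_denom M x (frag_of (m, s \<oplus>\<^bsub>S\<^esub> s') - frag_of (m, s) - frag_of (m, s'))
        = numerator x (s \<oplus>\<^bsub>S\<^esub> s') \<odot>\<^bsub>M\<^esub> m \<ominus>\<^bsub>M\<^esub> (numerator x s \<oplus>\<^bsub>R\<^esub> numerator x s') \<odot>\<^bsub>M\<^esub> m"
        using m s
        by (simp add: clear_denom_diff[OF M] clear_denom_spec(2)[OF M] keys_diff_subset keys_frag_of numerator_closed
          M.smult_l_distr a_minus_def M.M.a_assoc M.M.minus_add)
      ultimately show ?thesis
        by simp
    qed
    then show ?case
      by (intro bexI[OF _ L] ballI) simp
  next
    case (smult r m s)
    then have s: "s \<in> carrier S" and m: "m \<in> carrier M" and r: "r \<in> carrier R"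
      by simp_all
    obtain I J where I: "I \<in> \<F>" "\<forall>x\<in>I. \<phi> (numerator x s) = \<phi> x \<otimes>\<^bsub>S\<^esub> s"
      and J: "J \<in> \<F>" "\<forall>x\<in>J. \<phi> (numerator x (\<phi> r \<otimes>\<^bsub>S\<^esub> s)) = \<phi> x \<otimes>\<^bsub>S\<^esub> (\<phi> r \<otimes>\<^bsub>S\<^esub> s)"
      using ex_numerator[of s] ex_numerator[of "\<phi> r \<otimes>\<^bsub>S\<^esub> s"] s r by auto
    have L: "I \<inter> J \<in> \<F>"
      by (intro F_Int I J)
    have "clear_denom M x (frag_of (r \<odot>\<^bsub>M\<^esub> m, s) - frag_of (m, \<phi> r \<otimes>\<^bsub>S\<^esub> s)) \<in> torsion R \<F> M"
      if x: "x \<in> I \<inter> J" for x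
    proof -
      have "x \<in> carrier R"
        using F_subset[OF L] x by blast
      then have "\<phi> (numerator x s \<otimes>\<^bsub>R\<^esub> r) = \<phi> (numerator x (\<phi> r \<otimes>\<^bsub>S\<^esub> s))"
        using x I J s r by (simp add: numerator_closed S.m_ac)
      then have "(numerator x s \<otimes>\<^bsub>R\<^esub> r) \<odot>\<^bsub>M\<^esub> m \<ominus>\<^bsub>M\<^esub> numerator x (\<phi> r \<otimes>\<^bsub>S\<^esub> s) \<odot>\<^bsub>M\<^esub> m \<in> torsion R \<F> M"
        using m r by (intro smult_diff_torsion[OF M]) (simp_all add: numerator_closed)
      then show ?thesis
        using m s r
        by (simp add: clear_denom_diff[OF M] clear_denom_spec(2)[OF M] keys_frag_of numerator_closed M.smult_assoc1)
    qed
    then show ?case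
      by (intro bexI[OF _ L] ballI) simp
  qed
qed

text \<open>Multiplication by \<open>s\<close> on \<open>M \<otimes> S\<close>, on the level of formal sums.\<close>

abbreviation scale where
  "scale s \<equiv> frag_extend (\<lambda>(m, t). frag_of (m, s \<otimes>\<^bsub>S\<^esub> t))"

context
  fixes M :: "('a, 'x, 'e) module_scheme"
  assumes M: "module R M"
begin

interpretation M: gabriel_module R \<F> M
  by (intro gabriel_module.intro gabriel_system_axioms M)

interpretation TM: tensor_modules R M "restrict_scalars \<phi> S"
  by (intro tensor_modules.intro M SM.module_axioms)

lemma scale_kernel:
  assumes "c \<in> TM.K" and s: "s \<in> carrier S"
  shows "scale s c \<in> TM.K"
  using assms(1)
proof (induction rule: TM.K_induct)
  case zero
  then show ?case
    by (simp add: TM.K_zero)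
next
  case (diff a b)
  then show ?case
    by (simp add: frag_extend_diff TM.K_diff)
next
  case (add_left m m' t)
  then show ?case
    using TM.K_add_left[of m m' "s \<otimes>\<^bsub>S\<^esub> t"] s by (simp add: frag_extend_diff)
next
  case (add_right m t t')
  then show ?case
    using TM.K_add_right[of m "s \<otimes>\<^bsub>S\<^esub> t" "s \<otimes>\<^bsub>S\<^esub> t'"] s by (simp add: frag_extend_diff S.r_distr)
next
  case (smult r m t)
  then show ?case
    using TM.K_smult[of r m "s \<otimes>\<^bsub>S\<^esub> t"] s by (simp add: frag_extend_diff S.m_lcomm)
qed

lemma scale_scale:
  assumes "Poly_Mapping.keys w \<subseteq> carrier M \<times> carrier S" "s \<in> carrier S" "t \<in> carrier S"
  shows "scale s (scale t w) = scale (s \<otimes>\<^bsub>S\<^esub> t) w"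
  using assms(1)
  by (induction rule: free_Abelian_group_induct[consumes 1])
    (use assms(2,3) in \<open>auto simp: frag_extend_diff S.m_assoc\<close>)

lemma scale_one:
  assumes "Poly_Mapping.keys w \<subseteq> carrier M \<times> carrier S"
  shows "scale \<one>\<^bsub>S\<^esub> w = w"
  using assms
  by (induction rule: free_Abelian_group_induct[consumes 1]) (auto simp: frag_extend_diff)

lemma scale_add:
  assumes "Poly_Mapping.keys w \<subseteq> carrier M \<times> carrier S" "s \<in> carrier S" "t \<in> carrier S"
  shows "scale (s \<oplus>\<^bsub>S\<^esub> t) w - scale s w - scale t w \<in> TM.K"
  using assms(1)
proof (induction rule: free_Abelian_group_induct[consumes 1])
  case 1
  then show ?case
    by (simp add: TM.K_zero)
next
  case (2 a b)
  then show ?case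
    using TM.K_diff[OF 2(3,4)] by (simp add: frag_extend_diff algebra_simps)
next
  case (3 p)
  then show ?case
    using assms(2,3) TM.K_add_right[of "fst p" "s \<otimes>\<^bsub>S\<^esub> snd p" "t \<otimes>\<^bsub>S\<^esub> snd p"]
    by (auto simp: S.l_distr)
qed

text \<open>The local-to-global principle for \<open>M \<otimes> S\<close>: the \<open>s\<close> that kill the class of \<open>w\<close> form an ideal
  of \<open>S\<close>, because \<open>M \<otimes> S\<close> is an \<open>S\<close>-module.\<close>

lemma scale_local:
  assumes w: "Poly_Mapping.keys w \<subseteq> carrier M \<times> carrier S" and I: "I \<in> \<F>"
    and kill: "\<And>x. x \<in> I \<Longrightarrow> scale (\<phi> x) w \<in> TM.K"
  shows "w \<in> TM.K"
proof -
  let ?A = "{s \<in> carrier S. scale s w \<in> TM.K}"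
  have mult: "t \<otimes>\<^bsub>S\<^esub> s \<in> ?A" if "s \<in> ?A" "t \<in> carrier S" for s t
    using that scale_kernel[of "scale s w" t] scale_scale[OF w, of t s] by simp
  have "?A = carrier S"
  proof (rule ideal_eq_carrier[OF I])
    show "ideal ?A S"
    proof (rule idealI[OF S.ring_axioms])
      show "subgroup ?A (add_monoid S)"
      proof (rule S.add.subgroupI)
        \<comment> \<open>\<open>scale 0 w\<close> need not be the zero sum; up to sign it is \<open>(0 + 0) w - 0 w - 0 w\<close>.\<close>
        have "scale \<zero>\<^bsub>S\<^esub> w \<in> TM.K"
          using TM.K_uminus[OF scale_add[OF w, of "\<zero>\<^bsub>S\<^esub>" "\<zero>\<^bsub>S\<^esub>"]] by simp
        then show "?A \<noteq> {}"
          by blast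
      next
        fix a assume "a \<in> ?A"
        then show "\<ominus>\<^bsub>S\<^esub> a \<in> ?A"
          using mult[of a "\<ominus>\<^bsub>S\<^esub> \<one>\<^bsub>S\<^esub>"] by (simp add: S.l_minus)
      next
        fix a b assume ab: "a \<in> ?A" "b \<in> ?A"
        then have "(scale (a \<oplus>\<^bsub>S\<^esub> b) w - scale a w - scale b w) + scale a w + scale b w \<in> TM.K"
          by (intro TM.K_add scale_add[OF w]) auto
        then show "a \<oplus>\<^bsub>S\<^esub> b \<in> ?A"
          using ab by simp
      qed auto
    qed (use mult S.m_comm in auto)
    show "\<phi> ` I \<subseteq> ?A"
      using kill F_subset[OF I] by auto
  qed
  then have "\<one>\<^bsub>S\<^esub> \<in> ?A"
    by simp
  then show ?thesis
    using scale_one[OF w] by simp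
qed

text \<open>If \<open>x\<close> annihilates \<open>m\<close>, then \<open>x (m \<otimes> s) = x m \<otimes> s = 0\<close>.\<close>

lemma torsion_tensor_zero:
  assumes m: "m \<in> torsion R \<F> M" and s: "s \<in> carrier S"
  shows "frag_of (m, s) \<in> TM.K"
proof -
  have mM: "m \<in> carrier M" and ann: "annihilator R M m \<in> \<F>"
    using m by (auto simp: torsion_def)
  show ?thesis
  proof (rule scale_local[OF _ ann])
    show "Poly_Mapping.keys (frag_of (m, s)) \<subseteq> carrier M \<times> carrier S"
      using mM s by (simp add: keys_frag_of)
    fix x assume "x \<in> annihilator R M m"
    then have x: "x \<in> carrier R" "x \<odot>\<^bsub>M\<^esub> m = \<zero>\<^bsub>M\<^esub>"
      by (auto simp: annihilator_def)
    show "scale (\<phi> x) (frag_of (m, s)) \<in> TM.K"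
      using TM.K_diff[OF TM.K_zero_left[of s] TM.K_smult[of x m s]] x mM s by simp
  qed
qed

text \<open>On a generator this is \<open>m \<otimes> \<phi> x \<cdot> s = m \<otimes> \<phi> y = y m \<otimes> 1\<close> with \<open>y\<close> the numerator of \<open>s\<close> over \<open>x\<close>.\<close>

lemma scale_eq_clear_denom:
  assumes "Poly_Mapping.keys w \<subseteq> carrier M \<times> carrier S"
  shows "\<exists>I\<in>\<F>. \<forall>x\<in>I. scale (\<phi> x) w - frag_of (clear_denom M x w, \<one>\<^bsub>S\<^esub>) \<in> TM.K"
  using assms
proof (induction rule: free_Abelian_group_induct[consumes 1])
  case 1
  show ?case
    using F_carrier TM.K_uminus[OF TM.K_zero_left[of "\<one>\<^bsub>S\<^esub>"]] by (auto simp: clear_denom_zero[OF M])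
next
  case (2 a b)
  then obtain I J where I: "I \<in> \<F>" "\<forall>x\<in>I. scale (\<phi> x) a - frag_of (clear_denom M x a, \<one>\<^bsub>S\<^esub>) \<in> TM.K"
    and J: "J \<in> \<F>" "\<forall>x\<in>J. scale (\<phi> x) b - frag_of (clear_denom M x b, \<one>\<^bsub>S\<^esub>) \<in> TM.K"
    by blast
  have "scale (\<phi> x) (a - b) - frag_of (clear_denom M x (a - b), \<one>\<^bsub>S\<^esub>) \<in> TM.K" if x: "x \<in> I \<inter> J" for x
  proof -
    let ?a = "clear_denom M x a" and ?b = "clear_denom M x b"
    have ab: "?a \<in> carrier M" "?b \<in> carrier M"
      using clear_denom_closed[OF M] 2 by simp_all
    have eq: "(?a \<ominus>\<^bsub>M\<^esub> ?b) \<oplus>\<^bsub>M\<^esub> ?b = ?a"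
      using ab by (simp add: a_minus_def M.M.a_assoc M.M.l_neg)
    have "frag_of (?a, \<one>\<^bsub>S\<^esub>) - frag_of (?a \<ominus>\<^bsub>M\<^esub> ?b, \<one>\<^bsub>S\<^esub>) - frag_of (?b, \<one>\<^bsub>S\<^esub>) \<in> TM.K"
      using TM.K_add_left[of "?a \<ominus>\<^bsub>M\<^esub> ?b" ?b "\<one>\<^bsub>S\<^esub>"] ab eq by simp
    from TM.K_add[OF TM.K_diff[OF bspec[OF I(2)] bspec[OF J(2)]] this, of x x] x
    show ?thesis
      using clear_denom_diff[OF M 2(1,2)] by (simp add: frag_extend_diff algebra_simps)
  qed
  then show ?case
    using F_Int[OF I(1) J(1)] by blast
next
  case (3 p)
  then obtain m s where p: "p = (m, s)" and m: "m \<in> carrier M" and s: "s \<in> carrier S"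
    by blast
  obtain I where I: "I \<in> \<F>" "\<forall>x\<in>I. \<phi> (numerator x s) = \<phi> x \<otimes>\<^bsub>S\<^esub> s"
    using ex_numerator[OF s] by blast
  have "scale (\<phi> x) (frag_of p) - frag_of (clear_denom M x (frag_of p), \<one>\<^bsub>S\<^esub>) \<in> TM.K" if x: "x \<in> I" for x
  proof -
    have "x \<in> carrier R"
      using F_subset[OF I(1)] x by blast
    then have "scale (\<phi> x) (frag_of p) - frag_of (clear_denom M x (frag_of p), \<one>\<^bsub>S\<^esub>)
        = - (frag_of (numerator x s \<odot>\<^bsub>M\<^esub> m, \<one>\<^bsub>S\<^esub>) - frag_of (m, numerator x s \<odot>\<^bsub>restrict_scalars \<phi> S\<^esub> \<one>\<^bsub>S\<^esub>))"
      using bspec[OF I(2) x] m s by (simp add: p clear_denom_spec(2)[OF M] numerator_closed)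
    then show ?thesis
      using TM.K_uminus[OF TM.K_smult[of "numerator x s" m "\<one>\<^bsub>S\<^esub>"]] m by (simp add: numerator_closed)
  qed
  then show ?case
    using I(1) by blast
qed

text \<open>The criterion for \<open>w\<close> to vanish in \<open>M \<otimes> S\<close> refers only to torsion in \<open>M\<close>. If the cleared
  elements \<open>m\<close> are torsion, then \<open>x w = m \<otimes> 1 = 0\<close> for all \<open>x\<close> in a member of \<open>\<F>\<close>, so \<open>w = 0\<close>.\<close>

lemma kernel_iff_clear_denom_torsion:
  assumes w: "Poly_Mapping.keys w \<subseteq> carrier M \<times> carrier S"
  shows "w \<in> tensor_kernel R M (restrict_scalars \<phi> S)
    \<longleftrightarrow> (\<exists>I\<in>\<F>. \<forall>x\<in>I. clear_denom M x w \<in> torsion R \<F> M)"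
proof
  assume "w \<in> TM.K"
  then show "\<exists>I\<in>\<F>. \<forall>x\<in>I. clear_denom M x w \<in> torsion R \<F> M"
    by (rule clear_denom_kernel_torsion[OF M])
next
  assume "\<exists>I\<in>\<F>. \<forall>x\<in>I. clear_denom M x w \<in> torsion R \<F> M"
  then obtain I where I: "I \<in> \<F>" "\<forall>x\<in>I. clear_denom M x w \<in> torsion R \<F> M"
    by blast
  obtain J where J: "J \<in> \<F>" "\<forall>x\<in>J. scale (\<phi> x) w - frag_of (clear_denom M x w, \<one>\<^bsub>S\<^esub>) \<in> TM.K"
    using scale_eq_clear_denom[OF w] by blast
  show "w \<in> TM.K"
  proof (rule scale_local[OF w F_Int[OF I(1) J(1)]])
    fix x assume x: "x \<in> I \<inter> J"
    then have "frag_of (clear_denom M x w, \<one>\<^bsub>S\<^esub>) \<in> TM.K"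
      using I(2) by (intro torsion_tensor_zero) auto
    with J(2) x show "scale (\<phi> x) w \<in> TM.K"
      using TM.K_add[of "scale (\<phi> x) w - frag_of (clear_denom M x w, \<one>\<^bsub>S\<^esub>)" "frag_of (clear_denom M x w, \<one>\<^bsub>S\<^esub>)"]
      by simp
  qed
qed

end

lemma clear_denom_natural:
  assumes M: "module R M" and M': "module R M'" and u: "u \<in> lin_maps R M M'"
    and w: "Poly_Mapping.keys w \<subseteq> carrier M \<times> carrier S"
  shows "clear_denom M' x (frag_extend (\<lambda>(m, s). frag_of (u m, s)) w) = u (clear_denom M x w)"
proof -
  interpret M: module R M by fact
  interpret M': module R M' by fact
  note u_simps = lin_mapsD[OF u] lin_maps_zero[OF M M' u]
  have u_minus: "u (m \<ominus>\<^bsub>M\<^esub> m') = u m \<ominus>\<^bsub>M'\<^esub> u m'" if "m \<in> carrier M" "m' \<in> carrier M" for m m'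
    using that u_simps(3)[of "\<ominus>\<^bsub>R\<^esub> \<one>\<^bsub>R\<^esub>" m']
    by (simp add: a_minus_def u_simps(1,2) M.smult_l_minus M'.smult_l_minus)
  have keys: "Poly_Mapping.keys (frag_extend (\<lambda>(m, s). frag_of (u m, s)) a) \<subseteq> carrier M' \<times> carrier S"
    if "Poly_Mapping.keys a \<subseteq> carrier M \<times> carrier S" for a :: "_ \<Rightarrow>\<^sub>0 int"
    by (rule keys_frag_extend_subset[OF that]) (auto simp: keys_frag_of u_simps)
  show ?thesis
    using w
  proof (induction rule: free_Abelian_group_induct[consumes 1])
    case 1
    then show ?case
      by (simp add: clear_denom_zero[OF M] clear_denom_zero[OF M'] u_simps)
  next
    case (2 a b)
    then show ?case
      by (simp add: frag_extend_diff clear_denom_diff[OF M] clear_denom_diff[OF M'] keys u_minus clear_denom_closed[OF M])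
  next
    case (3 p)
    then show ?case
      by (auto simp: clear_denom_spec(2)[OF M] clear_denom_spec(2)[OF M'] u_simps numerator_closed)
  qed
qed

text \<open>Clearing denominators commutes with \<open>u\<close>, and an injective \<open>u\<close> reflects torsion; so the criterion
  for vanishing passes from the image of \<open>w\<close> back to \<open>w\<close>.\<close>

lemma flat: "flat_module TYPE('m) TYPE('n) R (restrict_scalars \<phi> S)"
  unfolding flat_module_def
proof (intro conjI allI impI)
  show "module R (restrict_scalars \<phi> S)"
    by (rule SM.module_axioms)
  fix M :: "('a, 'm) module" and M' :: "('a, 'n) module" and u
  assume M: "module R M" and M': "module R M'" and u: "u \<in> lin_maps R M M'"
    and inj: "inj_on u (carrier M)"
  interpret M: module R M by fact
  interpret M': module R M' by fact
  note u_simps = lin_mapsD[OF u] lin_maps_zero[OF M M' u]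
  have torsion_iff: "u m \<in> torsion R \<F> M' \<longleftrightarrow> m \<in> torsion R \<F> M" if m: "m \<in> carrier M" for m
  proof -
    have "r \<odot>\<^bsub>M'\<^esub> u m = \<zero>\<^bsub>M'\<^esub> \<longleftrightarrow> r \<odot>\<^bsub>M\<^esub> m = \<zero>\<^bsub>M\<^esub>" if r: "r \<in> carrier R" for r
      using inj_on_eq_iff[OF inj, of "r \<odot>\<^bsub>M\<^esub> m" "\<zero>\<^bsub>M\<^esub>"] m r by (simp add: u_simps)
    then have "annihilator R M' (u m) = annihilator R M m"
      by (auto simp: annihilator_def)
    then show ?thesis
      using m u_simps(1)[OF m] by (simp add: torsion_def)
  qed
  show "inj_on (tensor_map R M' (restrict_scalars \<phi> S) u) (carrier (tensor R M (restrict_scalars \<phi> S)))"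
  proof (rule tensor_map_inj_on[OF M M' SM.module_axioms u])
    fix w :: "('m \<times> 'c) \<Rightarrow>\<^sub>0 int"
    let ?U = "frag_extend (\<lambda>(m, s). frag_of (u m, s))"
    assume "Poly_Mapping.keys w \<subseteq> carrier M \<times> carrier (restrict_scalars \<phi> S)"
      and Uw: "?U w \<in> tensor_kernel R M' (restrict_scalars \<phi> S)"
    then have w: "Poly_Mapping.keys w \<subseteq> carrier M \<times> carrier S"
      by simp
    have "clear_denom M' x (?U w) \<in> torsion R \<F> M' \<longleftrightarrow> clear_denom M x w \<in> torsion R \<F> M" for x
      using clear_denom_natural[OF M M' u w] torsion_iff[OF clear_denom_closed[OF M w]] by simp
    then show "w \<in> tensor_kernel R M (restrict_scalars \<phi> S)"
      using clear_denom_kernel_torsion[OF M' Uw] kernel_iff_clear_denom_torsion[OF M w] by simp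
  qed
qed

end

section \<open>Ring maps isomorphic to the localization\<close>

locale gabriel_isomorphism = gabriel_expanding +
  fixes \<psi>
  assumes iso: "\<psi> \<in> ring_iso (gab_ring R \<F>) S"
    and factors: "r \<in> carrier R \<Longrightarrow> \<phi> r = \<psi> (gab_unit R \<F> (self_module R) r)"
begin

lemma unit_in_gab_ring: "r \<in> carrier R \<Longrightarrow> gab_unit R \<F> (self_module R) r \<in> carrier (gab_ring R \<F>)"
  using self.gab_unit_carrier[of r] by (simp add: gab_ring_def)

lemma iso_mult_eq:
  assumes A: "A \<in> carrier (gab_ring R \<F>)" and If: "(I, f) \<in> A" and x: "x \<in> I"
    and y: "y \<in> carrier R" and fx: "f x = torsion R \<F> (self_module R) +>\<^bsub>R\<^esub> y"
  shows "\<phi> x \<otimes>\<^bsub>S\<^esub> \<psi> A = \<phi> y"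
proof -
  have "A \<in> carrier (gab_module R \<F> (self_module R))"
    using A by (simp add: gab_ring_def)
  from self.gab_repsD(3)[OF self.gab_carrier_reps[OF this If]]
  have xR: "x \<in> carrier R"
    using x by blast
  have "\<psi> (gab_unit R \<F> (self_module R) x \<otimes>\<^bsub>gab_ring R \<F>\<^esub> A) = \<psi> (gab_unit R \<F> (self_module R) x) \<otimes>\<^bsub>S\<^esub> \<psi> A"
    using iso unit_in_gab_ring[OF xR] A by (simp add: ring_iso_def ring_hom_mult)
  moreover have "gab_unit R \<F> (self_module R) x \<otimes>\<^bsub>gab_ring R \<F>\<^esub> A = gab_unit R \<F> (self_module R) y"
    using gab_mult_unit[OF A If x y fx] by (simp add: gab_ring_def)
  ultimately show ?thesis
    using factors[OF xR] factors[OF y] by simp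
qed

text \<open>A ring homomorphism is only required to respect sums, products and 1, so the image of the unit
  class of \<open>r\<close> is compared with that of the unit class of 0, which is \<open>\<phi> 0 = 0\<close>.\<close>

lemma iso_kernel_torsion:
  assumes r: "r \<in> carrier R" and "\<phi> r = \<zero>\<^bsub>S\<^esub>"
  shows "r \<in> torsion R \<F> (self_module R)"
proof -
  have inj: "inj_on \<psi> (carrier (gab_ring R \<F>))"
    using iso by (simp add: ring_iso_def bij_betw_def)
  have "\<psi> (gab_unit R \<F> (self_module R) r) = \<psi> (gab_unit R \<F> (self_module R) \<zero>)"
    using assms by (simp flip: factors)
  then have "gab_unit R \<F> (self_module R) r = gab_unit R \<F> (self_module R) \<zero>"
    using inj_onD[OF inj] r by (simp add: unit_in_gab_ring)
  then have "r \<ominus> \<zero> \<in> torsion R \<F> (self_module R)"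
    using self.gab_unit_eqD[of r \<zero>] r by simp
  then show ?thesis
    using r by (simp add: a_minus_def)
qed

lemma iso_denominators:
  assumes "s \<in> carrier S"
  shows "\<exists>I\<in>\<F>. \<forall>x\<in>I. \<exists>y\<in>carrier R. \<phi> x \<otimes>\<^bsub>S\<^esub> s = \<phi> y"
proof -
  have "\<psi> ` carrier (gab_ring R \<F>) = carrier S"
    using iso by (simp add: ring_iso_def bij_betw_def)
  with assms obtain A where A: "A \<in> carrier (gab_ring R \<F>)" "s = \<psi> A"
    by blast
  then have "A \<in> carrier (gab_module R \<F> (self_module R))"
    by (simp add: gab_ring_def)
  then obtain I f where f: "(I, f) \<in> gab_reps R \<F> (self_module R)" "(I, f) \<in> A"
    by (rule self.gab_carrierE)
  have "\<exists>y\<in>carrier R. \<phi> x \<otimes>\<^bsub>S\<^esub> s = \<phi> y" if x: "x \<in> I" for x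
  proof -
    obtain y where y: "y \<in> carrier R" "f x = torsion R \<F> (self_module R) +>\<^bsub>R\<^esub> y"
      using self.gab_repsD(4)[OF f(1) x] by auto
    show ?thesis
      using iso_mult_eq[OF A(1) f(2) x y] A(2) y(1) by blast
  qed
  then show ?thesis
    using self.gab_repsD(1)[OF f(1)] by blast
qed

lemma iso_eq_inv_gab_map:
  assumes A: "A \<in> carrier (gab_ring R \<F>)"
  shows "\<psi> A = inv_into (carrier S) (gab_unit R \<F> (restrict_scalars \<phi> S))
               (gab_map R \<F> (restrict_scalars \<phi> S) \<phi> A)"
proof -
  have "\<psi> A \<in> carrier S"
    using iso A ring_hom_closed[of \<psi> "gab_ring R \<F>" S] by (simp add: ring_iso_def)
  then show ?thesis
    using gab_map_eq_unit[OF A] iso_mult_eq[OF A] inv_into_f_f[OF gab_unit_inj] by simp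
qed

end

sublocale gabriel_isomorphism \<subseteq> gabriel_fractions R \<F> S \<phi>
  by unfold_locales (rule iso_kernel_torsion iso_denominators; assumption)+

theorem theorem3p6:
  fixes R :: "('a, 'c) ring_scheme" and S :: "('b, 'd) ring_scheme"
    and \<F> :: "'a set set" and \<phi> :: "'a \<Rightarrow> 'b"
    and \<psi> :: "('a set \<times> ('a \<Rightarrow> 'a set)) set \<Rightarrow> 'b"
  assumes "cring R" and "cring S"
    and "topologizing_system R \<F>" and "idempotent_system R \<F>"
    and "\<phi> \<in> ring_hom R S"
    and "\<forall>I\<in>\<F>. Idl\<^bsub>S\<^esub> (\<phi> ` I) = carrier S"
    and "\<psi> \<in> ring_iso (gab_ring R \<F>) S"
    and "\<forall>r\<in>carrier R. \<phi> r = \<psi> (gab_unit R \<F> (self_module R) r)"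
  shows "flat_epimorphism TYPE('m) TYPE('n) TYPE('t) R S \<phi> \<and>
    (\<forall>x\<in>carrier (gab_ring R \<F>).
       \<psi> x = inv_into (carrier S) (gab_unit R \<F> (restrict_scalars \<phi> S))
               (gab_map R \<F> (restrict_scalars \<phi> S) \<phi> x))"
proof -
  interpret gabriel_isomorphism R \<F> S \<phi> \<psi>
    using assms
    by (intro gabriel_isomorphism.intro gabriel_expanding.intro gabriel_system.intro
        gabriel_system_axioms.intro gabriel_expanding_axioms.intro gabriel_isomorphism_axioms.intro)
      simp_all
  have "ring_epimorphism TYPE('t) R S \<phi>"
    unfolding ring_epimorphism_def
  proof (intro conjI allI impI ballI)
    fix T :: "'t ring" and g h s
    assume "cring T" "g \<in> ring_hom S T" "h \<in> ring_hom S T"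
      and "\<forall>r\<in>carrier R. g (\<phi> r) = h (\<phi> r)" and "s \<in> carrier S"
    then show "g s = h s"
      by (intro epimorphism[of T g h s]) simp_all
  qed (rule hom)
  with flat have "flat_epimorphism TYPE('m) TYPE('n) TYPE('t) R S \<phi>"
    unfolding flat_epimorphism_def by blast
  with iso_eq_inv_gab_map show ?thesis
    by blast
qed

end
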